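(* The random variable $V^{(2)}/V^{(1)}$ has a continuously differentiable density function.
   Context: Parameters: $\alpha\in(1,2)$, $\mu_A\in(0,1)$, $\sigma_A^2\in(0,\infty)$, $\theta:=1-\mu_A^\alpha$. $(V^{(1)},V^{(2)})$ is a random vector with $$(V^{(1)},V^{(2)})\stackrel{d}{=}\biggl(\frac{1}{1-\mu_A^2}\sum_{i=1}^\infty P_i^2,\ \frac{1}{(1-\mu_A^3)^{1/2}}\sum_{i=1}^\infty P_i^{3/2}Z_i\biggr),$$ where $\sum_{i=1}^\infty\delta_{P_i}$ is a Poisson point process on $(0,\infty)$ with intensity $\theta\alpha y^{-\alpha-1}\,\mathrm{d}y$, with $P_1\ge P_2\ge\cdots$ almost surely, and $(Z_i)_{i\ge1}$ is an i.i.d. sequence of $\mathcal{N}(0,\sigma_A^2)$-distributed random variables independent of it; both series converge almost surely and $V^{(1)}>0$ almost surely. Equivalently, its joint characteristic function is $$\mathbb{E}\bigl[\mathrm{e}^{\mathrm{i}(sV^{(1)}+tV^{(2)})}\bigr]=\exp\biggl\{\theta\int_0^\infty\biggl(\exp\biggl\{\frac{\mathrm{i}s}{1-\mu_A^2}y^2-\frac{\sigma_A^2t^2}{2(1-\mu_A^3)}y^3\biggr\}-1\biggr)\alpha y^{-\alpha-1}\,\mathrm{d}y\biggr\},\quad s,t\in\mathbb{R}.$$ *)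

theory Defs
  imports "HOL-Probability.Probability"
begin

definition sum_dirac :: "(nat \<Rightarrow> 'a::topological_space) \<Rightarrow> 'a measure" where
  \<comment> \<open>The point measure \<open>\<Sum>i. \<delta>(x i)\<close>: its value on a Borel set \<open>A\<close> is the number of
     indices \<open>i\<close> with \<open>x i \<in> A\<close>, counted with multiplicity and possibly infinite.\<close>
  "sum_dirac x = distr (count_space UNIV) borel x"

definition poisson_point_process :: "'w measure \<Rightarrow> 'a measure \<Rightarrow> ('w \<Rightarrow> 'a measure) \<Rightarrow> bool" where
  \<comment> \<open>\<open>\<xi>\<close> is a Poisson point process with intensity measure \<open>\<Lambda>\<close> on the probability space \<open>M\<close>.
     The Poisson law is spelled out through its point masses so that rate \<open>0\<close> is covered;
     rate \<open>\<infinity>\<close> means an almost surely infinite number of points.\<close>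
  "poisson_point_process M \<Lambda> \<xi> \<longleftrightarrow>
     (\<forall>\<omega>\<in>space M. sets (\<xi> \<omega>) = sets \<Lambda>) \<and>
     (\<forall>A\<in>sets \<Lambda>. (\<lambda>\<omega>. emeasure (\<xi> \<omega>) A) \<in> borel_measurable M) \<and>
     (\<forall>A\<in>sets \<Lambda>. emeasure \<Lambda> A < \<infinity> \<longrightarrow>
        (\<forall>k::nat. measure M {\<omega> \<in> space M. emeasure (\<xi> \<omega>) A = of_nat k}
           = exp (- measure \<Lambda> A) * measure \<Lambda> A ^ k / fact k)) \<and>
     (\<forall>A\<in>sets \<Lambda>. emeasure \<Lambda> A = \<infinity> \<longrightarrow> (AE \<omega> in M. emeasure (\<xi> \<omega>) A = \<infinity>)) \<and>
     (\<forall>(n::nat) A. (\<forall>i<n. A i \<in> sets \<Lambda>) \<longrightarrow> disjoint_family_on A {..<n} \<longrightarrow>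
        prob_space.indep_vars M (\<lambda>_. borel) (\<lambda>i \<omega>. emeasure (\<xi> \<omega>) (A i)) {..<n})"

definition intensity :: "real \<Rightarrow> real \<Rightarrow> real measure" where
  \<comment> \<open>The measure \<open>\<theta> \<alpha> y\<^sup>-\<^sup>\<alpha>\<^sup>-\<^sup>1 dy\<close> on \<open>(0, \<infinity>)\<close>, regarded as a measure on the whole real line
     that gives no mass to \<open>(-\<infinity>, 0]\<close>.\<close>
  "intensity \<theta> \<alpha> =
     density lborel (\<lambda>y. ennreal (\<theta> * \<alpha> * y powr (- \<alpha> - 1)) * indicator {0<..} y)"

definition iid_normal :: "'w measure \<Rightarrow> real \<Rightarrow> (nat \<Rightarrow> 'w \<Rightarrow> real) \<Rightarrow> bool" where
  \<comment> \<open>I.i.d. with law \<open>N(0, \<sigma>\<^sup>2)\<close>; \<^const>\<open>normal_density\<close> takes the standard deviation \<open>\<sigma>\<close>.\<close>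
  "iid_normal M \<sigma> Z \<longleftrightarrow>
     prob_space.indep_vars M (\<lambda>_. borel) Z UNIV \<and>
     (\<forall>i. distributed M lborel (Z i) (\<lambda>x. ennreal (normal_density 0 \<sigma> x)))"

definition series_vector ::
  "real \<Rightarrow> (nat \<Rightarrow> 'w \<Rightarrow> real) \<Rightarrow> (nat \<Rightarrow> 'w \<Rightarrow> real) \<Rightarrow> 'w \<Rightarrow> real \<times> real" where
  \<comment> \<open>The points and the Gaussian variables are indexed from \<open>0\<close> instead of \<open>1\<close>.\<close>
  "series_vector \<mu> P Z \<omega> =
     (1 / (1 - \<mu>\<^sup>2) * (\<Sum>i. (P i \<omega>)\<^sup>2),
      1 / (1 - \<mu> ^ 3) powr (1/2) * (\<Sum>i. P i \<omega> powr (3/2) * Z i \<omega>))"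

end

theory Submission
  imports Defs
begin

text \<open>
  Write \<open>S2 = (\<Sum>i. (P i)\<^sup>2)\<close> and \<open>S3 = (\<Sum>i. P i ^ 3)\<close>. Given the points \<open>P\<close>, the numerator
  \<open>V2\<close> is a series of independent centred Gaussian variables, and \<open>V1\<close> is a constant. Hence
  \<open>V2 / V1\<close> is conditionally centred Gaussian, and its standard deviation is \<open>1 / r\<close> with \<open>r\<^sup>2\<close> a
  constant multiple of \<open>S2\<^sup>2 / S3\<close>. Averaging over \<open>P\<close>, the quotient has the density
  \<open>f x = E (r * \<phi> (r * x))\<close> with \<open>\<phi>\<close> the standard normal density (\<open>distributed_mixture\<close>). The
  derivative of the integrand in \<open>x\<close> is at most \<open>r\<^sup>2\<close> in absolute value, uniformly in \<open>x\<close>, so \<open>f\<close> is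
  continuously differentiable as soon as \<open>E (r\<^sup>2)\<close> is finite (\<open>normal_scale_mixture_C1\<close>).

  It remains to see that \<open>S2\<^sup>2 / S3\<close> is integrable (\<open>ratio_finite\<close>), although \<open>S2\<close> itself has infinite
  mean. A single huge point \<open>y\<close> contributes \<open>y ^ 4\<close> to the numerator but also \<open>y ^ 3\<close> to the
  denominator. So only the first power of the large points counts, which is integrable for
  \<open>\<alpha> > 1\<close>. The small points have a sum of squares with a finite fourth moment, because \<open>\<alpha> < 2\<close>, and
  \<open>S3\<close> has finite negative moments, because it is very unlikely that all points are small. All of this
  is read off from the numbers of points above dyadic levels, which are Poisson variables. Their
  marginal laws suffice, since every product is split by Cauchy--Schwarz or by
  \<open>2 * (a * b) \<le> a\<^sup>2 + b\<^sup>2\<close>.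

  The conditional Gaussian law is \<open>distributed_normal_series\<close>. The coefficients \<open>P i powr (3/2)\<close> are
  square summable but need not be summable, so in general the series converges only through cancellation: its
  almost sure convergence is the one-series theorem \<open>AE_summable_of_summable_variance\<close>, which rests on
  Kolmogorov's maximal inequality.
\<close>

section \<open>Almost sure convergence of series of independent variables\<close>

text \<open>
  Freezing the partial sums as soon as they leave \<open>(-\<epsilon>, \<epsilon>)\<close> reduces the maximum to a single
  random variable: the stopped sum ends outside the interval exactly when some partial sum leaves
  it. Each step of the stopped sum adds \<open>X k\<close> multiplied by an indicator that depends on earlier
  variables only, so by independence the mixed term vanishes and the second moment grows by at most
  the variance of \<open>X k\<close>. Chebyshev's inequality for the stopped sum then gives the bound.
\<close>

lemma (in prob_space) kolmogorov_maximal_inequality: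
  fixes X :: "nat \<Rightarrow> 'a \<Rightarrow> real"
  assumes indep: "indep_vars (\<lambda>_. borel) X UNIV"
    and sq: "\<And>i. integrable M (\<lambda>\<omega>. (X i \<omega>)\<^sup>2)"
    and centered: "\<And>i. expectation (X i) = 0"
    and "0 < \<epsilon>"
  shows "prob {\<omega> \<in> space M. \<exists>k\<le>n. \<epsilon> \<le> \<bar>\<Sum>i=m..<m+k. X i \<omega>\<bar>}
           \<le> (\<Sum>i=m..<m+n. expectation (\<lambda>\<omega>. (X i \<omega>)\<^sup>2)) / \<epsilon>\<^sup>2"
proof -
  define step where "step = (\<lambda>(s::real) x. if \<bar>s\<bar> < \<epsilon> then s + x else s)"
  define y where "y = (\<lambda>(x::nat \<Rightarrow> real) k. rec_nat 0 (\<lambda>j s. step s (x (m + j))) k)"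
  have y_0: "y x 0 = 0" and y_Suc: "y x (Suc k) = step (y x k) (x (m + k))" for x k
    by (simp_all add: y_def)
  define Y where "Y = (\<lambda>k \<omega>. y (\<lambda>i. X i \<omega>) k)"
  have X_meas [measurable]: "X i \<in> borel_measurable M" for i
    using indep by (auto simp: indep_vars_def)
  have step_meas [measurable]: "(\<lambda>x. step (f x) (g x)) \<in> borel_measurable N"
    if [measurable]: "f \<in> borel_measurable N" "g \<in> borel_measurable N" for f g and N :: "'z measure"
    unfolding step_def by measurable
  have step_meas' [measurable]: "(\<lambda>x. step (f x) (g x)) \<in> borel_measurable N"
    if [measurable]: "f \<in> borel_measurable N" "g \<in> borel_measurable N" for f g
      and N :: "(nat \<Rightarrow> real) measure"
    unfolding step_def by measurable
  have Y_meas [measurable]: "Y k \<in> borel_measurable M" for k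
    unfolding Y_def by (induction k) (simp_all add: y_0 y_Suc step_meas)
  have int_X: "integrable M (X i)" for i
    by (rule square_integrable_imp_integrable[OF X_meas sq])
  have y_restrict: "y (restrict x {m..<m+k}) j = y x j" if "j \<le> k" for x j k
    using that by (induction j) (auto simp: y_0 y_Suc)
  have y_meas: "(\<lambda>x. y x j) \<in> borel_measurable (PiM {m..<m+k} (\<lambda>_. borel))" if "j \<le> k" for j k
    using that
  proof (induction j)
    case (Suc j)
    then have [measurable]: "(\<lambda>x. x (m + j)) \<in> borel_measurable (PiM {m..<m+k} (\<lambda>_. borel :: real measure))"
      by (intro measurable_component_singleton) auto
    show ?case using Suc unfolding y_Suc by (intro step_meas') auto
  qed (simp add: y_0)
  define h where "h = (\<lambda>s::real. if \<bar>s\<bar> < \<epsilon> then s else 0)"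
  have h_meas [measurable]: "h \<in> borel_measurable borel"
    unfolding h_def by measurable
  \<comment> \<open>The past of the walk enters through the first \<open>k\<close> variables only, hence it is independent of the
      next increment. Passing to \<open>h (Y k \<omega>)\<close> keeps that factor bounded, so the mixed term is
      integrable.\<close>
  have indep_hY: "indep_var borel (\<lambda>\<omega>. h (Y k \<omega>)) borel (X (m + k))" for k
  proof -
    have 1: "indep_var
       borel ((\<lambda>x. h (y x k)) \<circ> (\<lambda>\<omega>. restrict (\<lambda>i. X i \<omega>) {m..<m+k}))
       borel ((\<lambda>x. x (m + k)) \<circ> (\<lambda>\<omega>. restrict (\<lambda>i. X i \<omega>) {m + k}))"
      using y_meas[of k k]
      by (intro indep_var_compose[OF indep_var_restrict[OF indep]]) auto
    show ?thesis
      using 1 by (simp add: comp_def y_restrict Y_def)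
  qed
  have int_h: "integrable M (\<lambda>\<omega>. h (Y k \<omega>))" for k
    using \<open>0 < \<epsilon>\<close> by (intro integrable_const_bound[where B=\<epsilon>]) (auto simp: h_def)
  have Y_0: "Y 0 \<omega> = 0" and Y_Suc: "Y (Suc k) \<omega> = step (Y k \<omega>) (X (m + k) \<omega>)" for k \<omega>
    by (simp_all add: Y_def y_0 y_Suc)
  have sq_step: "(Y (Suc k) \<omega>)\<^sup>2 = (Y k \<omega>)\<^sup>2 + 2 * (h (Y k \<omega>) * X (m + k) \<omega>)
      + (if \<bar>Y k \<omega>\<bar> < \<epsilon> then 1 else 0) * (X (m + k) \<omega>)\<^sup>2" for k \<omega>
    by (auto simp: Y_Suc step_def h_def power2_eq_square algebra_simps)
  have int_ind: "integrable M (\<lambda>\<omega>. (if \<bar>Y k \<omega>\<bar> < \<epsilon> then 1 else 0) * (X (m + k) \<omega>)\<^sup>2)" for k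
    by (rule Bochner_Integration.integrable_bound[OF sq[of "m + k"]]) auto
  have int_hX: "integrable M (\<lambda>\<omega>. h (Y k \<omega>) * X (m + k) \<omega>)" for k
    by (rule indep_var_integrable[OF indep_hY int_h int_X])
  have E_hX: "expectation (\<lambda>\<omega>. h (Y k \<omega>) * X (m + k) \<omega>) = 0" for k
    using indep_var_lebesgue_integral[OF indep_hY int_h int_X] by (simp add: centered)
  have Y_sq: "integrable M (\<lambda>\<omega>. (Y k \<omega>)\<^sup>2) \<and>
      expectation (\<lambda>\<omega>. (Y k \<omega>)\<^sup>2) \<le> (\<Sum>i=m..<m+k. expectation (\<lambda>\<omega>. (X i \<omega>)\<^sup>2))" for k
  proof (induction k)
    case (Suc k)
    have "expectation (\<lambda>\<omega>. (if \<bar>Y k \<omega>\<bar> < \<epsilon> then 1 else 0) * (X (m + k) \<omega>)\<^sup>2)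
       \<le> expectation (\<lambda>\<omega>. (X (m + k) \<omega>)\<^sup>2)"
      by (intro integral_mono int_ind sq) auto
    with Suc show ?case
      by (auto simp: sq_step int_ind int_hX E_hX)
  qed (simp add: Y_0)
  have Y_eq: "Y k \<omega> = (\<Sum>i=m..<m+k. X i \<omega>)"
    if "\<forall>j<k. \<bar>\<Sum>i=m..<m+j. X i \<omega>\<bar> < \<epsilon>" for k \<omega>
    using that by (induction k) (auto simp: Y_0 Y_Suc step_def)
  have frozen: "Y (k + j) \<omega> = Y k \<omega>" if "\<epsilon> \<le> \<bar>Y k \<omega>\<bar>" for k j \<omega>
    using that by (induction j) (auto simp: Y_Suc step_def)
  \<comment> \<open>Up to its first exit the stopped sum agrees with the walk, and it stays where it exited.\<close>
  have "{\<omega> \<in> space M. \<exists>k\<le>n. \<epsilon> \<le> \<bar>\<Sum>i=m..<m+k. X i \<omega>\<bar>} \<subseteq> {\<omega> \<in> space M. \<epsilon> \<le> \<bar>Y n \<omega>\<bar>}"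
  proof safe
    fix \<omega> k
    assume "k \<le> n" and big: "\<epsilon> \<le> \<bar>\<Sum>i=m..<m+k. X i \<omega>\<bar>"
    define k0 where "k0 = (LEAST k. \<epsilon> \<le> \<bar>\<Sum>i=m..<m+k. X i \<omega>\<bar>)"
    have k0: "\<epsilon> \<le> \<bar>\<Sum>i=m..<m+k0. X i \<omega>\<bar>"
      unfolding k0_def using big by (rule LeastI)
    have "k0 \<le> n"
      using Least_le[of "\<lambda>k. \<epsilon> \<le> \<bar>\<Sum>i=m..<m+k. X i \<omega>\<bar>" k] \<open>k \<le> n\<close> big
      unfolding k0_def by linarith
    have "\<bar>\<Sum>i=m..<m+j. X i \<omega>\<bar> < \<epsilon>" if "j < k0" for j
      using not_less_Least[of j "\<lambda>k. \<epsilon> \<le> \<bar>\<Sum>i=m..<m+k. X i \<omega>\<bar>"] that unfolding k0_def by linarith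
    then have "Y k0 \<omega> = (\<Sum>i=m..<m+k0. X i \<omega>)"
      by (intro Y_eq) auto
    then show "\<epsilon> \<le> \<bar>Y n \<omega>\<bar>"
      using frozen[of k0 \<omega> "n - k0"] k0 \<open>k0 \<le> n\<close> by simp
  qed
  then have "prob {\<omega> \<in> space M. \<exists>k\<le>n. \<epsilon> \<le> \<bar>\<Sum>i=m..<m+k. X i \<omega>\<bar>}
      \<le> prob {\<omega> \<in> space M. \<epsilon> \<le> \<bar>Y n \<omega>\<bar>}"
    by (intro finite_measure_mono) auto
  also have "\<dots> \<le> expectation (\<lambda>\<omega>. (Y n \<omega>)\<^sup>2) / \<epsilon>\<^sup>2"
    using Y_sq[of n] \<open>0 < \<epsilon>\<close> by (intro second_moment_method) auto
  also have "\<dots> \<le> (\<Sum>i=m..<m+n. expectation (\<lambda>\<omega>. (X i \<omega>)\<^sup>2)) / \<epsilon>\<^sup>2"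
    using Y_sq[of n] by (intro divide_right_mono) auto
  finally show ?thesis .
qed

text \<open>
  By the maximal inequality, the oscillation of the partial sums after index \<open>m\<close> exceeds \<open>\<epsilon>\<close> with
  probability at most the tail of the variance series divided by \<open>\<epsilon>\<^sup>2\<close>. The tails tend to zero, so
  almost surely the partial sums form a Cauchy sequence.
\<close>

lemma (in prob_space) AE_summable_of_summable_variance:
  fixes X :: "nat \<Rightarrow> 'a \<Rightarrow> real"
  assumes indep: "indep_vars (\<lambda>_. borel) X UNIV"
    and sq: "\<And>i. integrable M (\<lambda>\<omega>. (X i \<omega>)\<^sup>2)"
    and centered: "\<And>i. expectation (X i) = 0"
    and summable: "summable (\<lambda>i. expectation (\<lambda>\<omega>. (X i \<omega>)\<^sup>2))"
  shows "AE \<omega> in M. summable (\<lambda>i. X i \<omega>)"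
proof -
  define v where "v = (\<lambda>i. expectation (\<lambda>\<omega>. (X i \<omega>)\<^sup>2))"
  have v_nonneg: "0 \<le> v i" for i
    by (simp add: v_def)
  have X_meas [measurable]: "X i \<in> borel_measurable M" for i
    using indep by (auto simp: indep_vars_def)
  have osc: "prob {\<omega> \<in> space M. \<exists>k. \<epsilon> \<le> \<bar>\<Sum>i=m..<m+k. X i \<omega>\<bar>} \<le> (\<Sum>i. v (i + m)) / \<epsilon>\<^sup>2"
    if "0 < \<epsilon>" for \<epsilon> m
  proof -
    define E where "E = (\<lambda>n. {\<omega> \<in> space M. \<exists>k\<le>n. \<epsilon> \<le> \<bar>\<Sum>i=m..<m+k. X i \<omega>\<bar>})"
    have "(\<lambda>n. prob (E n)) \<longlonglongrightarrow> prob (\<Union>n. E n)"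
      by (intro finite_Lim_measure_incseq) (auto simp: E_def incseq_def intro: order_trans)
    moreover have "prob (E n) \<le> (\<Sum>i. v (i + m)) / \<epsilon>\<^sup>2" for n
    proof -
      have "prob (E n) \<le> (\<Sum>i=m..<m+n. v i) / \<epsilon>\<^sup>2"
        unfolding E_def v_def by (rule kolmogorov_maximal_inequality) fact+
      also have "(\<Sum>i=m..<m+n. v i) = (\<Sum>i<n. v (i + m))"
        using sum.shift_bounds_nat_ivl[of v 0 m n] by (simp add: lessThan_atLeast0 add.commute)
      also have "\<dots> \<le> (\<Sum>i. v (i + m))"
        using summable_iff_shift[of v m] summable v_nonneg
        by (intro sum_le_suminf) (auto simp: v_def[symmetric])
      finally show ?thesis
        by (simp add: divide_right_mono)
    qed
    ultimately have "prob (\<Union>n. E n) \<le> (\<Sum>i. v (i + m)) / \<epsilon>\<^sup>2"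
      by (intro LIMSEQ_le_const2) auto
    also have "(\<Union>n. E n) = {\<omega> \<in> space M. \<exists>k. \<epsilon> \<le> \<bar>\<Sum>i=m..<m+k. X i \<omega>\<bar>}"
      by (auto simp: E_def)
    finally show ?thesis .
  qed
  have "AE \<omega> in M. \<exists>m. \<forall>k. \<bar>\<Sum>i=m..<m+k. X i \<omega>\<bar> < \<epsilon>" if "0 < \<epsilon>" for \<epsilon>
  proof -
    define D where "D = (\<lambda>m. {\<omega> \<in> space M. \<exists>k. \<epsilon> \<le> \<bar>\<Sum>i=m..<m+k. X i \<omega>\<bar>})"
    have D_sets [measurable]: "D m \<in> sets M" for m
      unfolding D_def by measurable
    have "(\<lambda>m. (\<Sum>i. v (i + m)) / \<epsilon>\<^sup>2) \<longlonglongrightarrow> 0 / \<epsilon>\<^sup>2"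
      using summable unfolding v_def[symmetric]
      by (intro tendsto_divide suminf_exist_split2 tendsto_const) (use \<open>0 < \<epsilon>\<close> in auto)
    moreover have "prob (\<Inter>m. D m) \<le> (\<Sum>i. v (i + m)) / \<epsilon>\<^sup>2" for m
    proof -
      have "prob (\<Inter>m. D m) \<le> prob (D m)"
        by (intro finite_measure_mono) auto
      also have "\<dots> \<le> (\<Sum>i. v (i + m)) / \<epsilon>\<^sup>2"
        unfolding D_def by (rule osc) fact
      finally show ?thesis .
    qed
    ultimately have "prob (\<Inter>m. D m) \<le> 0"
      by (intro LIMSEQ_le_const[of _ _ "prob (\<Inter>m. D m)"]) auto
    then have "prob (\<Inter>m. D m) = 0"
      by (simp add: measure_le_0_iff)
    then have "AE \<omega> in M. \<omega> \<notin> (\<Inter>m. D m)"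
      by (intro AE_not_in) (simp add: null_sets_def emeasure_eq_measure)
    with AE_space show ?thesis
      by eventually_elim (auto simp: D_def not_le)
  qed
  then have "AE \<omega> in M. \<forall>j. \<exists>m. \<forall>k. \<bar>\<Sum>i=m..<m+k. X i \<omega>\<bar> < 1 / Suc j"
    by (subst AE_all_countable) auto
  then show ?thesis
  proof eventually_elim
    case (elim \<omega>)
    show "summable (\<lambda>i. X i \<omega>)"
      unfolding summable_Cauchy
    proof (intro allI impI)
      fix e :: real
      assume "0 < e"
      then obtain j where j: "1 / Suc j < e / 2"
        using nat_approx_posE[of "e / 2"] by auto
      obtain N where "\<forall>k. \<bar>\<Sum>i=N..<N+k. X i \<omega>\<bar> < 1 / Suc j"
        using elim by blast
      then have N: "\<bar>\<Sum>i=N..<n. X i \<omega>\<bar> < e / 2" if "N \<le> n" for n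
        using j that by (metis le_Suc_ex less_trans)
      have "norm (\<Sum>i=m..<n. X i \<omega>) < e" if "N \<le> m" for m n
      proof (cases "m \<le> n")
        case True
        then have "(\<Sum>i=m..<n. X i \<omega>) = (\<Sum>i=N..<n. X i \<omega>) - (\<Sum>i=N..<m. X i \<omega>)"
          using that sum.atLeastLessThan_concat[of N m n "\<lambda>i. X i \<omega>"] by simp
        then show ?thesis
          using N[of m] N[of n] that True by (auto simp: abs_real_def split: if_splits)
      qed (use \<open>0 < e\<close> in auto)
      then show "\<exists>N. \<forall>m\<ge>N. \<forall>n. norm (\<Sum>i=m..<n. X i \<omega>) < e"
        by blast
    qed
  qed
qed

section \<open>Series of independent Gaussian variables\<close>

lemma (in prob_space) char_normal:
  assumes "0 < \<sigma>" and D: "distributed M lborel X (\<lambda>x. ennreal (normal_density 0 \<sigma> x))"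
  shows "char (distr M borel (\<lambda>\<omega>. c * X \<omega>)) t = complex_of_real (exp (- (c * \<sigma> * t)\<^sup>2 / 2))"
proof -
  have X [measurable]: "X \<in> borel_measurable M"
    using D by (auto simp: distributed_def)
  have std: "distributed M lborel (\<lambda>\<omega>. X \<omega> / \<sigma>) (\<lambda>x. ennreal (std_normal_density x))"
    using normal_standard_normal_convert[OF \<open>0 < \<sigma>\<close>, of X 0] D by simp
  then have law: "distr M borel (\<lambda>\<omega>. X \<omega> / \<sigma>) = std_normal_distribution"
    by (simp add: distributed_def cong: distr_cong)
  have "char (distr M borel (\<lambda>\<omega>. c * X \<omega>)) t
      = (CLINT \<omega>|M. iexp (t * (c * X \<omega>)))"
    unfolding char_def by (subst integral_distr) auto
  also have "\<dots> = (CLINT \<omega>|M. iexp ((c * \<sigma> * t) * (X \<omega> / \<sigma>)))"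
    using \<open>0 < \<sigma>\<close> by (intro Bochner_Integration.integral_cong) (simp_all add: ac_simps)
  also have "\<dots> = char (distr M borel (\<lambda>\<omega>. X \<omega> / \<sigma>)) (c * \<sigma> * t)"
    unfolding char_def by (subst integral_distr) auto
  finally show ?thesis
    by (simp add: law char_std_normal_distribution)
qed

text \<open>
  The partial sums converge almost surely, hence their characteristic functions converge by dominated
  convergence; these are Gaussian with variances converging to \<open>\<sigma>\<^sup>2 * (\<Sum>i. (a i)\<^sup>2)\<close>. Levy's
  uniqueness theorem identifies the limit law with that of a multiple of \<open>Z 0\<close>.
\<close>

lemma (in prob_space) distributed_normal_series:
  assumes Z: "iid_normal M \<sigma> Z" and "0 < \<sigma>"
    and a: "summable (\<lambda>i. (a i)\<^sup>2)" and pos: "0 < (\<Sum>i. (a i)\<^sup>2)"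
  shows "distributed M lborel (\<lambda>\<omega>. \<Sum>i. a i * Z i \<omega>)
           (\<lambda>x. ennreal (normal_density 0 (\<sigma> * sqrt (\<Sum>i. (a i)\<^sup>2)) x))"
proof -
  have indep: "indep_vars (\<lambda>_. borel) Z UNIV"
    and D: "\<And>i. distributed M lborel (Z i) (\<lambda>x. ennreal (normal_density 0 \<sigma> x))"
    using Z by (auto simp: iid_normal_def)
  have Z_meas [measurable]: "Z i \<in> borel_measurable M" for i
    using D[of i] by (auto simp: distributed_def)
  have indep': "indep_vars (\<lambda>_. borel) (\<lambda>i \<omega>. a i * Z i \<omega>) UNIV"
    by (rule indep_vars_compose2[OF indep]) auto
  have E_sq: "expectation (\<lambda>\<omega>. (Z i \<omega>)\<^sup>2) = \<sigma>\<^sup>2" for i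
    using normal_distributed_variance[OF \<open>0 < \<sigma>\<close> D, of i]
      normal_distributed_expectation[OF \<open>0 < \<sigma>\<close> D, of i] by simp
  have int_sq: "integrable M (\<lambda>\<omega>. (Z i \<omega>)\<^sup>2)" for i
    using E_sq[of i] \<open>0 < \<sigma>\<close> not_integrable_integral_eq by force
  have AE: "AE \<omega> in M. summable (\<lambda>i. a i * Z i \<omega>)"
    using normal_distributed_expectation[OF \<open>0 < \<sigma>\<close> D]
    by (intro AE_summable_of_summable_variance[OF indep'])
       (auto simp: power_mult_distrib E_sq int_sq intro!: summable_mult2 a)
  define v where "v = (\<Sum>i. (a i)\<^sup>2)"
  have char_partial: "char (distr M borel (\<lambda>\<omega>. \<Sum>i<n. a i * Z i \<omega>)) t
      = complex_of_real (exp (- (\<Sum>i<n. (a i)\<^sup>2) * (\<sigma> * t)\<^sup>2 / 2))" for n t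
  proof -
    have "char (distr M borel (\<lambda>\<omega>. \<Sum>i<n. a i * Z i \<omega>)) t
        = (\<Prod>i<n. char (distr M borel (\<lambda>\<omega>. a i * Z i \<omega>)) t)"
      by (rule char_distr_sum) (rule indep_vars_subset[OF indep'], simp)
    also have "\<dots> = complex_of_real (\<Prod>i<n. exp (- (a i * \<sigma> * t)\<^sup>2 / 2))"
      by (simp add: char_normal[OF \<open>0 < \<sigma>\<close> D])
    also have "(\<Prod>i<n. exp (- (a i * \<sigma> * t)\<^sup>2 / 2)) = exp (- (\<Sum>i<n. (a i)\<^sup>2) * (\<sigma> * t)\<^sup>2 / 2)"
      by (simp add: exp_sum[symmetric] sum_distrib_right sum_divide_distrib sum_negf power_mult_distrib mult.assoc)
    finally show ?thesis .
  qed
  have "char (distr M borel (\<lambda>\<omega>. \<Sum>i. a i * Z i \<omega>)) t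
      = complex_of_real (exp (- (sqrt v * \<sigma> * t)\<^sup>2 / 2))" for t
  proof (rule LIMSEQ_unique)
    show "(\<lambda>n. char (distr M borel (\<lambda>\<omega>. \<Sum>i<n. a i * Z i \<omega>)) t)
      \<longlonglongrightarrow> char (distr M borel (\<lambda>\<omega>. \<Sum>i. a i * Z i \<omega>)) t"
    proof -
      have "(\<lambda>n. CLINT \<omega>|M. iexp (t * (\<Sum>i<n. a i * Z i \<omega>)))
        \<longlonglongrightarrow> (CLINT \<omega>|M. iexp (t * (\<Sum>i. a i * Z i \<omega>)))"
      proof (rule integral_dominated_convergence[where w = "\<lambda>_. 1"])
        show "AE \<omega> in M. (\<lambda>n. iexp (t * (\<Sum>i<n. a i * Z i \<omega>)))
            \<longlonglongrightarrow> iexp (t * (\<Sum>i. a i * Z i \<omega>))"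
          using AE by eventually_elim (intro tendsto_intros summable_LIMSEQ)
      qed auto
      then show ?thesis
        by (simp add: char_def integral_distr)
    qed
    have "(\<lambda>n. complex_of_real (exp (- (\<Sum>i<n. (a i)\<^sup>2) * (\<sigma> * t)\<^sup>2 / 2)))
        \<longlonglongrightarrow> complex_of_real (exp (- (\<Sum>i. (a i)\<^sup>2) * (\<sigma> * t)\<^sup>2 / 2))"
      by (intro tendsto_intros summable_LIMSEQ a) auto
    also have "- (\<Sum>i. (a i)\<^sup>2) * (\<sigma> * t)\<^sup>2 / 2 = - (sqrt v * \<sigma> * t)\<^sup>2 / 2"
      using pos by (simp add: v_def power_mult_distrib)
    finally show "(\<lambda>n. char (distr M borel (\<lambda>\<omega>. \<Sum>i<n. a i * Z i \<omega>)) t)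
      \<longlonglongrightarrow> complex_of_real (exp (- (sqrt v * \<sigma> * t)\<^sup>2 / 2))"
      by (simp only: char_partial)
  qed
  then have "char (distr M borel (\<lambda>\<omega>. \<Sum>i. a i * Z i \<omega>)) = char (distr M borel (\<lambda>\<omega>. sqrt v * Z 0 \<omega>))"
    by (simp add: fun_eq_iff char_normal[OF \<open>0 < \<sigma>\<close> D])
  then have "distr M borel (\<lambda>\<omega>. \<Sum>i. a i * Z i \<omega>) = distr M borel (\<lambda>\<omega>. sqrt v * Z 0 \<omega>)"
    by (intro Levy_uniqueness real_distribution_distr) auto
  moreover have "distributed M lborel (\<lambda>\<omega>. sqrt v * Z 0 \<omega>)
      (\<lambda>x. ennreal (normal_density 0 (\<sigma> * sqrt v) x))"
    using normal_density_affine[OF D[of 0] \<open>0 < \<sigma>\<close>, of "sqrt v" 0] pos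
    by (simp add: v_def mult.commute)
  ultimately show "distributed M lborel (\<lambda>\<omega>. \<Sum>i. a i * Z i \<omega>)
        (\<lambda>x. ennreal (normal_density 0 (\<sigma> * sqrt (\<Sum>i. (a i)\<^sup>2)) x))"
    unfolding v_def[symmetric]
    by (auto simp: distributed_def cong: distr_cong)
qed

section \<open>Series of extended non-negative reals\<close>

lemma suminf_ennreal_commute:
  fixes f :: "nat \<Rightarrow> nat \<Rightarrow> ennreal"
  shows "(\<Sum>i. \<Sum>j. f i j) = (\<Sum>j. \<Sum>i. f i j)"
proof -
  have "(\<Sum>i. \<Sum>j. f i j) = (\<integral>\<^sup>+i. (\<Sum>j. f i j) \<partial>count_space UNIV)"
    by (simp add: nn_integral_count_space_nat)
  also have "\<dots> = (\<Sum>j. \<integral>\<^sup>+i. f i j \<partial>count_space UNIV)"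
    by (rule nn_integral_suminf) simp
  finally show ?thesis
    by (simp add: nn_integral_count_space_nat)
qed

lemma ennreal_two_mult_le_squares: "2 * (a * b) \<le> a\<^sup>2 + (b\<^sup>2 :: ennreal)"
proof (cases "a = \<top> \<or> b = \<top>")
  case False
  then obtain x y where "a = ennreal x" "0 \<le> x" "b = ennreal y" "0 \<le> y"
    by (cases a; cases b) auto
  moreover have "2 * (x * y) \<le> x\<^sup>2 + y\<^sup>2" for x y :: real
    using zero_le_power2[of "x - y"] by (simp add: power2_eq_square algebra_simps)
  ultimately show ?thesis
    by (simp add: ennreal_mult[symmetric] ennreal_power ennreal_numeral[symmetric] ennreal_plus[symmetric]
             del: ennreal_plus ennreal_numeral) 
qed (auto simp: power2_eq_square ennreal_top_mult ennreal_mult_top)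

text \<open>
  The Cauchy--Schwarz inequality for a weight of arbitrary, possibly infinite, total mass. Expanding
  the square into a double sum and bounding \<open>2 * (x i * x j)\<close> by \<open>(x i)\<^sup>2 + (x j)\<^sup>2\<close> avoids any case
  distinction on finiteness.
\<close>

lemma suminf_ennreal_weighted_CS:
  fixes w x :: "nat \<Rightarrow> ennreal"
  shows "(\<Sum>i. w i * x i)\<^sup>2 \<le> (\<Sum>i. w i) * (\<Sum>i. w i * (x i)\<^sup>2)"
proof -
  define D where "D = (\<Sum>i. w i) * (\<Sum>i. w i * (x i)\<^sup>2)"
  have D1: "(\<Sum>i. \<Sum>j. w i * (w j * (x j)\<^sup>2)) = D"
    by (simp add: D_def)
  have "(\<Sum>i. \<Sum>j. w i * (w j * (x i)\<^sup>2)) = (\<Sum>j. \<Sum>i. w i * (w j * (x i)\<^sup>2))"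
    by (rule suminf_ennreal_commute)
  also have "\<dots> = (\<Sum>j. \<Sum>i. w j * (w i * (x i)\<^sup>2))"
    by (simp only: mult.left_commute)
  finally have D2: "(\<Sum>i. \<Sum>j. w i * (w j * (x i)\<^sup>2)) = D"
    by (simp only: D1)
  have "2 * s\<^sup>2 = s * (s * 2)" for s :: ennreal
    by (simp add: power2_eq_square mult_ac)
  then have "2 * (\<Sum>i. w i * x i)\<^sup>2 = (\<Sum>i. (w i * x i) * (\<Sum>j. (w j * x j) * 2))"
    by (simp only: ennreal_suminf_multc)
  also have "\<dots> = (\<Sum>i. \<Sum>j. (w i * x i) * ((w j * x j) * 2))"
    by (simp only: ennreal_suminf_cmult)
  also have "\<dots> = (\<Sum>i. \<Sum>j. w i * (w j * (2 * (x i * x j))))"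
    by (simp only: mult_ac)
  also have "\<dots> \<le> (\<Sum>i. \<Sum>j. w i * (w j * ((x i)\<^sup>2 + (x j)\<^sup>2)))"
    by (intro suminf_le summableI mult_left_mono ennreal_two_mult_le_squares) auto
  also have "\<dots> = (\<Sum>i. (\<Sum>j. w i * (w j * (x i)\<^sup>2)) + (\<Sum>j. w i * (w j * (x j)\<^sup>2)))"
    by (simp only: distrib_left suminf_add[OF summableI summableI])
  also have "\<dots> = D + D"
    by (simp only: suminf_add[OF summableI summableI, symmetric] D1 D2)
  also have "\<dots> = 2 * D"
    by (simp add: mult_2)
  finally show ?thesis
    unfolding D_def[symmetric] by (subst (asm) ennreal_mult_le_mult_iff) auto
qed

section \<open>Moments of Poisson variables\<close>

context prob_space
begin

text \<open>
  The point masses already sum to one, so \<open>N\<close> is almost surely a natural number even though its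
  type also admits infinity and fractional values.
\<close>

lemma nn_integral_poisson:
  fixes N :: "'a \<Rightarrow> ennreal" and g :: "ennreal \<Rightarrow> ennreal"
  assumes [measurable]: "N \<in> borel_measurable M" "g \<in> borel_measurable borel" and "0 \<le> r"
    and N: "\<And>k::nat. prob {\<omega> \<in> space M. N \<omega> = of_nat k} = exp (- r) * r ^ k / fact k"
  shows "(\<integral>\<^sup>+\<omega>. g (N \<omega>) \<partial>M) = (\<Sum>k. g (of_nat k) * ennreal (exp (- r) * r ^ k / fact k))"
proof -
  define E where "E = (\<lambda>k::nat. {\<omega> \<in> space M. N \<omega> = of_nat k})"
  have E_sets [measurable]: "E k \<in> sets M" for k
    unfolding E_def by measurable
  have "(\<lambda>k. exp (- r) * (r ^ k / fact k)) sums (exp (- r) * exp r)"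
    using exp_converges[of r] by (intro sums_mult) (simp add: divide_inverse mult.commute)
  then have "(\<lambda>k. prob (E k)) sums 1"
    by (simp add: E_def N exp_minus_inverse mult.commute)
  moreover have "(\<lambda>k. prob (E k)) sums prob (\<Union>k. E k)"
    by (intro finite_measure_UNION) (auto simp: disjoint_family_on_def E_def)
  ultimately have "prob (\<Union>k. E k) = 1"
    using sums_unique2 by blast
  then have "AE \<omega> in M. \<omega> \<in> (\<Union>k. E k)"
    by (subst (asm) prob_eq_1) auto
  then have "(\<integral>\<^sup>+\<omega>. g (N \<omega>) \<partial>M) = (\<integral>\<^sup>+\<omega>. (\<Sum>k. g (of_nat k) * indicator (E k) \<omega>) \<partial>M)"
  proof (intro nn_integral_cong_AE, eventually_elim)
    case (elim \<omega>)
    then obtain k where k: "\<omega> \<in> E k"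
      by auto
    then have "indicator (E j) \<omega> = (if j = k then 1 else 0 :: ennreal)" for j
      by (auto simp: E_def indicator_def)
    then have "(\<Sum>j. g (of_nat j) * indicator (E j) \<omega>) = (\<Sum>j. if j = k then g (of_nat k) else 0)"
      by (intro suminf_cong) auto
    also have "\<dots> = g (N \<omega>)"
      using k sums_unique[OF sums_single[of k "\<lambda>_. g (of_nat k)"]] by (auto simp: E_def)
    finally show ?case
      by simp
  qed
  also have "\<dots> = (\<Sum>k. g (of_nat k) * ennreal (exp (- r) * r ^ k / fact k))"
    by (simp add: nn_integral_suminf nn_integral_cmult emeasure_eq_measure) (simp add: E_def N)
  finally show ?thesis .
qed

text \<open>
  The fourth moment is compared with the exponential moment of \<open>N / r\<close>, which is
  \<open>exp (r * (exp (1 / r) - 1)) \<le> exp (exp (1 / r))\<close>. What matters is that \<open>N / r\<close> has a fourth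
  moment that is bounded uniformly for rates \<open>r\<close> bounded away from zero.
\<close>

lemma
  fixes N :: "'a \<Rightarrow> ennreal"
  assumes [measurable]: "N \<in> borel_measurable M" and "0 < r"
    and N: "\<And>k::nat. prob {\<omega> \<in> space M. N \<omega> = of_nat k} = exp (- r) * r ^ k / fact k"
  shows nn_integral_poisson_mean: "(\<integral>\<^sup>+\<omega>. N \<omega> \<partial>M) = ennreal r"
    and nn_integral_poisson_fourth_moment:
      "(\<integral>\<^sup>+\<omega>. (N \<omega>) ^ 4 \<partial>M) \<le> ennreal (256 * exp (exp (1 / r)) * r ^ 4)"
proof -
  have exp_sums: "(\<lambda>k. exp (- r) * (x ^ k / fact k)) sums (exp (- r) * exp x)" for x :: real
    using exp_converges[of x] by (intro sums_mult) (simp add: divide_inverse mult.commute)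
  have "(\<integral>\<^sup>+\<omega>. N \<omega> \<partial>M) = (\<Sum>k. ennreal (real k * (exp (- r) * r ^ k / fact k)))"
    using \<open>0 < r\<close> unfolding nn_integral_poisson[where g="\<lambda>x. x", OF assms(1) measurable_ident_sets[OF refl] less_imp_le[OF \<open>0 < r\<close>] N]
    by (intro suminf_cong) (subst ennreal_mult, auto simp: ennreal_of_nat_eq_real_of_nat)
  also have "\<dots> = ennreal r"
  proof (rule suminf_ennreal_eq)
    have "(\<lambda>k. r * (exp (- r) * (r ^ k / fact k))) sums (r * (exp (- r) * exp r))"
      by (intro sums_mult exp_sums)
    then have "(\<lambda>k. real (Suc k) * (exp (- r) * r ^ Suc k / fact (Suc k))) sums r"
      by (simp add: exp_minus_inverse mult_ac del: of_nat_Suc)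
    then show "(\<lambda>k. real k * (exp (- r) * r ^ k / fact k)) sums r"
      by (subst (asm) sums_Suc_iff) simp
  qed (use \<open>0 < r\<close> in auto)
  finally show "(\<integral>\<^sup>+\<omega>. N \<omega> \<partial>M) = ennreal r" .
  define q where "q = exp (1 / r)"
  \<comment> \<open>An exponential bound at the scale \<open>1 / r\<close> of the variable \<open>N / r\<close>: it follows from
      \<open>x \<le> exp x\<close> at \<open>x = k / (4 * r)\<close>, and \<open>256 = 4 ^ 4\<close>.\<close>
  have fourth: "real k ^ 4 \<le> 256 * r ^ 4 * q ^ k" for k
  proof -
    have "(real k / r / 4) ^ 4 \<le> exp (real k / r / 4) ^ 4"
      using \<open>0 < r\<close> exp_ge_add_one_self[of "real k / r / 4"]
      by (intro power_mono) (linarith, simp)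
    also have "\<dots> = q ^ k"
      by (simp add: q_def exp_of_nat_mult[symmetric])
    finally show ?thesis
      using \<open>0 < r\<close> by (simp add: field_simps power_divide)
  qed
  have "(\<integral>\<^sup>+\<omega>. (N \<omega>) ^ 4 \<partial>M) = (\<Sum>k. ennreal (real k ^ 4 * (exp (- r) * r ^ k / fact k)))"
    using \<open>0 < r\<close> unfolding nn_integral_poisson[where g="\<lambda>x. x ^ 4", OF assms(1) _ less_imp_le[OF \<open>0 < r\<close>] N, simplified]
    by (intro suminf_cong) (subst ennreal_mult, auto simp: ennreal_of_nat_eq_real_of_nat ennreal_power)
  also have "\<dots> \<le> (\<Sum>k. ennreal (256 * r ^ 4 * (exp (- r) * ((r * q) ^ k / fact k))))"
  proof (intro suminf_le summableI ennreal_leI)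
    fix k :: nat
    have "real k ^ 4 * (exp (- r) * r ^ k / fact k)
       \<le> (256 * r ^ 4 * q ^ k) * (exp (- r) * r ^ k / fact k)"
      using \<open>0 < r\<close> by (intro mult_right_mono fourth) auto
    then show "real k ^ 4 * (exp (- r) * r ^ k / fact k)
       \<le> 256 * r ^ 4 * (exp (- r) * ((r * q) ^ k / fact k))"
      by (simp add: power_mult_distrib mult_ac)
  qed
  also have "\<dots> = ennreal (256 * r ^ 4 * (exp (- r) * exp (r * q)))"
    using \<open>0 < r\<close> by (intro suminf_ennreal_eq sums_mult exp_sums) (auto simp: q_def)
  also have "\<dots> \<le> ennreal (256 * exp q * r ^ 4)"
  proof (rule ennreal_leI)
    \<comment> \<open>This is \<open>r * (exp (1 / r) - 1) \<le> exp (1 / r)\<close>.\<close>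
    have "1 - 1 / r \<le> inverse q"
      using exp_ge_add_one_self[of "- (1 / r)"] by (simp add: q_def exp_minus)
    then have "q * (1 - 1 / r) \<le> q * inverse q"
      using \<open>0 < r\<close> by (intro mult_left_mono) (auto simp: q_def)
    then have "- r + r * q \<le> q"
      using \<open>0 < r\<close> by (simp add: q_def field_simps)
    then have "exp (- r) * exp (r * q) \<le> exp q"
      by (simp add: mult_exp_exp)
    then show "256 * r ^ 4 * (exp (- r) * exp (r * q)) \<le> 256 * exp q * r ^ 4"
      using \<open>0 < r\<close> by simp
  qed
  finally show "(\<integral>\<^sup>+\<omega>. (N \<omega>) ^ 4 \<partial>M) \<le> ennreal (256 * exp (exp (1 / r)) * r ^ 4)"
    by (simp add: q_def)
qed

end

section \<open>Dyadic bounds for sums over points\<close>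

definition count_above :: "(nat \<Rightarrow> real) \<Rightarrow> real \<Rightarrow> ennreal" where
  "count_above p x = (\<Sum>i. indicator {x<..} (p i))"

text \<open>
  A bound of \<open>g\<close> by a superposition of indicators of half-lines turns a sum over the points into a
  superposition of tail counts. For a Poisson process these are Poisson variables with an explicit
  rate.
\<close>

lemma suminf_le_layered_counts:
  assumes g: "\<And>i. g (p i) \<le> (\<Sum>k. c k * indicator {x k<..} (p i))"
  shows "(\<Sum>i. g (p i)) \<le> (\<Sum>k. c k * count_above p (x k))"
proof -
  have "(\<Sum>i. g (p i)) \<le> (\<Sum>i. \<Sum>k. c k * indicator {x k<..} (p i))"
    by (intro suminf_le summableI g)
  also have "\<dots> = (\<Sum>k. \<Sum>i. c k * indicator {x k<..} (p i))"
    by (rule suminf_ennreal_commute)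
  finally show ?thesis
    by (simp add: count_above_def)
qed

lemma ennreal_le_suminf: "f k \<le> (\<Sum>k. f k :: ennreal)"
  using sum_le_suminf[of f "{k}"] by (simp add: summableI)

lemma inverse_le_ennreal:
  assumes "0 < x" "ennreal x \<le> b"
  shows "inverse b \<le> ennreal (inverse x)"
proof (cases b)
  case (real y)
  with assms have "x \<le> y"
    by simp
  with assms have "inverse y \<le> inverse x"
    by (intro le_imp_inverse_le)
  with real assms \<open>x \<le> y\<close> show ?thesis
    by (simp add: inverse_ennreal ennreal_leI)
qed simp

text \<open>
  A point \<open>y\<close> with \<open>(1/2) ^ Suc k < y \<le> (1/2) ^ k\<close> contributes at most \<open>(1/4) ^ k\<close>.
\<close>

lemma suminf_small_squares_le:
  assumes pos: "\<And>i. 0 < p i"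
  shows "(\<Sum>i. ennreal ((p i)\<^sup>2) * indicator {..1} (p i))
           \<le> (\<Sum>k. ennreal ((1/4) ^ k) * count_above p ((1/2) ^ Suc k))"
proof (rule suminf_le_layered_counts)
  fix i
  define y where "y = p i"
  have "0 < y"
    using pos by (simp add: y_def)
  have "ennreal (y\<^sup>2) * indicator {..1} y
      \<le> (\<Sum>k. ennreal ((1/4) ^ k) * indicator {(1/2) ^ Suc k<..} y)"
  proof (cases "y \<le> 1")
    case True
    define m where "m = (LEAST m. (1/2 :: real) ^ m < y)"
    have ex: "\<exists>m. (1/2 :: real) ^ m < y"
      using \<open>0 < y\<close> by (intro real_arch_pow_inv) auto
    then have m: "(1/2) ^ m < y"
      unfolding m_def by (rule LeastI_ex)
    then obtain k where k: "m = Suc k"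
      using True by (cases m) auto
    then have "y \<le> (1/2) ^ k"
      using not_less_Least[of k "\<lambda>m. (1/2 :: real) ^ m < y"] unfolding m_def by simp
    then have "y\<^sup>2 \<le> ((1/2) ^ k)\<^sup>2"
      using \<open>0 < y\<close> by (intro power_mono) auto
    also have "\<dots> = (1/4) ^ k"
      by (simp add: power_mult[symmetric] mult.commute[of k 2]) (simp add: power_mult power2_eq_square)
    finally have "ennreal (y\<^sup>2) * indicator {..1} y \<le> ennreal ((1/4) ^ k) * indicator {(1/2) ^ Suc k<..} y"
      using True m k by (simp add: ennreal_leI)
    also have "\<dots> \<le> (\<Sum>k. ennreal ((1/4) ^ k) * indicator {(1/2) ^ Suc k<..} y)"
      by (rule ennreal_le_suminf)
    finally show ?thesis .
  qed simp
  then show "ennreal ((p i)\<^sup>2) * indicator {..1} (p i)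
      \<le> (\<Sum>k. ennreal ((1/4) ^ k) * indicator {(1/2) ^ Suc k<..} (p i))"
    by (simp only: y_def)
qed

text \<open>
  A point \<open>y\<close> with \<open>2 ^ k < y \<le> 2 ^ Suc k\<close> contributes at most \<open>2 ^ Suc k\<close>.
\<close>

lemma suminf_large_points_le:
  "(\<Sum>i. ennreal (p i) * indicator {1<..} (p i)) \<le> (\<Sum>k. ennreal (2 ^ Suc k) * count_above p (2 ^ k))"
proof (rule suminf_le_layered_counts)
  fix i
  define y where "y = p i"
  have "ennreal y * indicator {1<..} y \<le> (\<Sum>k. ennreal (2 ^ Suc k) * indicator {2 ^ k<..} y)"
  proof (cases "1 < y")
    case True
    define m where "m = (LEAST m. y \<le> 2 ^ m)"
    have ex: "\<exists>m. y \<le> 2 ^ m"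
      using real_arch_pow[of 2 y] by (auto intro: less_imp_le)
    then have m: "y \<le> 2 ^ m"
      unfolding m_def by (rule LeastI_ex)
    then obtain k where k: "m = Suc k"
      using True by (cases m) auto
    then have "2 ^ k < y"
      using not_less_Least[of k "\<lambda>m. y \<le> 2 ^ m"] unfolding m_def by simp
    then have "ennreal y * indicator {1<..} y \<le> ennreal (2 ^ Suc k) * indicator {2 ^ k<..} y"
      using True m k by (simp add: ennreal_leI del: power_Suc)
    also have "\<dots> \<le> (\<Sum>k. ennreal (2 ^ Suc k) * indicator {2 ^ k<..} y)"
      by (rule ennreal_le_suminf)
    finally show ?thesis .
  qed simp
  then show "ennreal (p i) * indicator {1<..} (p i) \<le> (\<Sum>k. ennreal (2 ^ Suc k) * indicator {2 ^ k<..} (p i))"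
    by (simp only: y_def)
qed

text \<open>
  The sum of the cubes is at least the cube of any single point. If \<open>(1/2) ^ Suc k\<close> is the first
  dyadic level that some point exceeds, then there is no point above \<open>(1/2) ^ k\<close> and the left-hand side is
  at most \<open>64 ^ Suc k\<close>; if the level \<open>1\<close> is already exceeded, it is at most \<open>1\<close>.
\<close>

lemma inverse_sum_cubes_le:
  assumes pos: "\<And>i. 0 < p i"
  shows "(inverse (\<Sum>i. ennreal (p i ^ 3)))\<^sup>2
           \<le> 1 + (\<Sum>k. ennreal (64 ^ Suc k) * indicator {0} (count_above p ((1/2) ^ k)))"
proof -
  define S where "S = (\<Sum>i. ennreal (p i ^ 3))"
  define m where "m = (LEAST m. \<exists>i. (1/2 :: real) ^ m < p i)"
  have "\<exists>m. (1/2 :: real) ^ m < p 0"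
    using pos by (intro real_arch_pow_inv) auto
  then have "\<exists>i. (1/2 :: real) ^ m < p i"
    unfolding m_def by (intro LeastI_ex[of "\<lambda>m. \<exists>i. (1/2 :: real) ^ m < p i"]) blast
  then obtain i where i: "(1/2) ^ m < p i"
    by blast
  have "ennreal (((1/2) ^ m) ^ 3) \<le> ennreal (p i ^ 3)"
    using i by (intro ennreal_leI power_mono) auto
  also have "\<dots> \<le> S"
    unfolding S_def by (rule ennreal_le_suminf)
  finally have "inverse S \<le> ennreal (inverse (((1/2) ^ m) ^ 3))"
    by (intro inverse_le_ennreal) auto
  also have "inverse (((1/2) ^ m) ^ 3) = (8 ^ m :: real)"
    by (simp add: power_mult[symmetric] mult.commute[of m 3])
       (simp add: power_mult power_one_over inverse_eq_divide power3_eq_cube)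
  finally have "(inverse S)\<^sup>2 \<le> (ennreal (8 ^ m))\<^sup>2"
    by (intro power_mono) auto
  also have "\<dots> = ennreal (64 ^ m)"
    by (simp add: ennreal_power power_mult[symmetric] mult.commute[of m 2]) (simp add: power_mult)
  also have "\<dots> \<le> 1 + (\<Sum>k. ennreal (64 ^ Suc k) * indicator {0} (count_above p ((1/2) ^ k)))"
  proof (cases m)
    case (Suc k)
    have "p j \<le> (1/2) ^ k" for j
      using not_less_Least[of k "\<lambda>m. \<exists>i. (1/2 :: real) ^ m < p i"] Suc
      unfolding m_def by (auto simp: not_less)
    then have "indicator {(1/2) ^ k<..} (p j) = (0 :: ennreal)" for j
      by (simp add: not_less)
    then have "count_above p ((1/2) ^ k) = 0"
      by (simp add: count_above_def)
    then have "ennreal (64 ^ m) \<le> ennreal (64 ^ Suc k) * indicator {0} (count_above p ((1/2) ^ k))"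
      by (simp add: Suc)
    also have "\<dots> \<le> (\<Sum>k. ennreal (64 ^ Suc k) * indicator {0} (count_above p ((1/2) ^ k)))"
      by (rule ennreal_le_suminf)
    also have "\<dots> \<le> 1 + (\<Sum>k. ennreal (64 ^ Suc k) * indicator {0} (count_above p ((1/2) ^ k)))"
      by simp
    finally show ?thesis .
  qed simp
  finally show ?thesis
    by (simp add: S_def)
qed

text \<open>
  The pathwise estimate behind the moment bound. The points above and below \<open>1\<close> are treated
  separately. For the large ones, Cauchy--Schwarz with the weight \<open>p i\<close> gives
  \<open>(\<Sum> p\<^sup>2)\<^sup>2 \<le> (\<Sum> p) * (\<Sum> p\<^sup>3)\<close>, and the second factor cancels against the denominator; the price
  is a first power of the large points, whose sum has finite mean for \<open>\<alpha> > 1\<close>. The small ones are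
  bounded by dyadic tail counts, normalised by \<open>l k\<close>, which later is their mean. Cauchy--Schwarz
  moves the square inside the sum over the levels, and the product of \<open>(x k)\<^sup>2\<close> with the reciprocal
  of the sum of cubes is split into squares, so that only moments of single factors remain.
\<close>

lemma square_ratio_le:
  fixes p l :: "nat \<Rightarrow> real"
  assumes pos: "\<And>i. 0 < p i" and l: "\<And>k. 0 < l k"
    and S: "(\<Sum>i. ennreal (p i ^ 3)) \<noteq> \<top>"
  defines "w \<equiv> \<lambda>k. ennreal ((1/4) ^ k * l k)"
    and "x \<equiv> \<lambda>k. count_above p ((1/2) ^ Suc k) / ennreal (l k)"
  shows "(\<Sum>i. ennreal ((p i)\<^sup>2))\<^sup>2 / (\<Sum>i. ennreal (p i ^ 3))
     \<le> 2 * (\<Sum>i. ennreal (p i) * indicator {1<..} (p i))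
       + 2 * ((\<Sum>k. w k) * (\<Sum>k. w k * ((x k) ^ 4 + (inverse (\<Sum>i. ennreal (p i ^ 3)))\<^sup>2)))"
proof -
  define S where "S = (\<Sum>i. ennreal (p i ^ 3))"
  define A where "A = (\<Sum>i. ennreal ((p i)\<^sup>2) * indicator {..1} (p i))"
  define B where "B = (\<Sum>i. ennreal ((p i)\<^sup>2) * indicator {1<..} (p i))"
  define B1 where "B1 = (\<Sum>i. ennreal (p i) * indicator {1<..} (p i))"
  have S_pos: "S \<noteq> 0"
    using pos[of 0] ennreal_le_suminf[of "\<lambda>i. ennreal (p i ^ 3)" 0] by (auto simp: S_def)
  have split: "(\<Sum>i. ennreal ((p i)\<^sup>2)) = A + B"
    unfolding A_def B_def
    by (subst suminf_add[OF summableI summableI]) (auto intro!: suminf_cong simp: indicator_def)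
  have B_le: "B\<^sup>2 \<le> B1 * S"
  proof -
    have "B\<^sup>2 = (\<Sum>i. (ennreal (p i) * indicator {1<..} (p i)) * ennreal (p i))\<^sup>2"
      using pos by (auto simp: B_def power2_eq_square ennreal_mult' less_imp_le mult_ac)
    also have "\<dots> \<le> B1 * (\<Sum>i. (ennreal (p i) * indicator {1<..} (p i)) * (ennreal (p i))\<^sup>2)"
      unfolding B1_def by (rule suminf_ennreal_weighted_CS)
    also have "\<dots> \<le> B1 * S"
      unfolding S_def
    proof (intro mult_left_mono suminf_le summableI)
      fix i
      show "ennreal (p i) * indicator {1<..} (p i) * (ennreal (p i))\<^sup>2 \<le> ennreal (p i ^ 3)"
        using pos[of i]
        by (auto simp: indicator_def ennreal_power ennreal_mult'[symmetric] power2_eq_square power3_eq_cube mult_ac)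
    qed auto
    finally show ?thesis .
  qed
  have A_le: "A \<le> (\<Sum>k. w k * x k)"
  proof -
    have "A \<le> (\<Sum>k. ennreal ((1/4) ^ k) * count_above p ((1/2) ^ Suc k))"
      unfolding A_def by (rule suminf_small_squares_le) fact
    also have "\<dots> = (\<Sum>k. w k * x k)"
    proof (rule suminf_cong)
      fix k
      have "ennreal (l k) * (c / ennreal (l k)) = c" for c
        using l[of k] by (simp add: ennreal_times_divide ennreal_mult_divide_eq mult.commute)
      then show "ennreal ((1/4) ^ k) * count_above p ((1/2) ^ Suc k) = w k * x k"
        using l[of k] unfolding w_def x_def by (simp add: ennreal_mult less_imp_le mult.assoc del: power_Suc)
    qed
    finally show ?thesis .
  qed
  have "A\<^sup>2 \<le> (\<Sum>k. w k * x k)\<^sup>2"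
    by (intro power_mono A_le) simp
  also have "\<dots> \<le> (\<Sum>k. w k) * (\<Sum>k. w k * (x k)\<^sup>2)"
    by (rule suminf_ennreal_weighted_CS)
  finally have "A\<^sup>2 * inverse S \<le> (\<Sum>k. w k) * (\<Sum>k. w k * (x k)\<^sup>2) * inverse S"
    by (rule mult_right_mono) simp
  also have "\<dots> = (\<Sum>k. w k) * (\<Sum>k. w k * ((x k)\<^sup>2 * inverse S))"
    by (simp only: mult.assoc[symmetric] ennreal_suminf_multc)
  also have "\<dots> \<le> (\<Sum>k. w k) * (\<Sum>k. w k * ((x k) ^ 4 + (inverse S)\<^sup>2))"
  proof (intro mult_left_mono suminf_le summableI)
    fix k
    have "(x k)\<^sup>2 * inverse S \<le> 2 * ((x k)\<^sup>2 * inverse S)"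
      by (simp add: mult_2)
    also have "\<dots> \<le> ((x k)\<^sup>2)\<^sup>2 + (inverse S)\<^sup>2"
      by (rule ennreal_two_mult_le_squares)
    finally show "(x k)\<^sup>2 * inverse S \<le> (x k) ^ 4 + (inverse S)\<^sup>2"
      by (simp add: power_mult[symmetric])
  qed auto
  finally have A_part: "A\<^sup>2 * inverse S \<le> (\<Sum>k. w k) * (\<Sum>k. w k * ((x k) ^ 4 + (inverse S)\<^sup>2))" .
  have "B\<^sup>2 * inverse S \<le> B1 * S * inverse S"
    by (intro mult_right_mono B_le) simp
  also have "\<dots> = B1"
    using S S_pos by (simp add: S_def[symmetric] divide_ennreal_def[symmetric] ennreal_mult_divide_eq)
  finally have B_part: "B\<^sup>2 * inverse S \<le> B1" .
  have "(A + B)\<^sup>2 = A\<^sup>2 + B\<^sup>2 + 2 * (A * B)"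
    by (simp only: power2_eq_square distrib_left distrib_right mult_2 add_ac mult.commute[of B A])
  also have "\<dots> \<le> A\<^sup>2 + B\<^sup>2 + (A\<^sup>2 + B\<^sup>2)"
    by (intro add_left_mono ennreal_two_mult_le_squares)
  also have "\<dots> = 2 * B\<^sup>2 + 2 * A\<^sup>2"
    by (simp add: mult_2 add_ac)
  finally have "(A + B)\<^sup>2 / S \<le> (2 * B\<^sup>2 + 2 * A\<^sup>2) * inverse S"
    unfolding divide_ennreal_def by (intro mult_right_mono) auto
  also have "\<dots> = 2 * (B\<^sup>2 * inverse S) + 2 * (A\<^sup>2 * inverse S)"
    by (simp add: distrib_right mult.assoc)
  also have "\<dots> \<le> 2 * B1 + 2 * ((\<Sum>k. w k) * (\<Sum>k. w k * ((x k) ^ 4 + (inverse S)\<^sup>2)))"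
    by (intro add_mono mult_left_mono A_part B_part) auto
  finally show ?thesis
    unfolding split S_def B1_def .
qed

section \<open>Poisson points with a power law intensity\<close>

lemma emeasure_sum_dirac:
  fixes p :: "nat \<Rightarrow> 'a::topological_space"
  assumes "A \<in> sets borel"
  shows "emeasure (sum_dirac p) A = (\<Sum>i. indicator A (p i))"
proof -
  have "emeasure (sum_dirac p) A = (\<integral>\<^sup>+i. indicator A (p i) \<partial>count_space UNIV)"
    unfolding sum_dirac_def using assms
    by (subst nn_integral_indicator[symmetric], simp, subst nn_integral_distr) auto
  then show ?thesis
    by (simp add: nn_integral_count_space_nat)
qed

lemma emeasure_intensity_greaterThan:
  assumes "0 < x" "0 < \<alpha>" "0 < \<theta>"
  shows "emeasure (intensity \<theta> \<alpha>) {x<..} = ennreal (\<theta> * x powr (- \<alpha>))"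
proof -
  have "emeasure (intensity \<theta> \<alpha>) {x<..}
      = (\<integral>\<^sup>+y. ennreal (\<theta> * \<alpha> * y powr (- \<alpha> - 1)) * indicator {0<..} y * indicator {x<..} y \<partial>lborel)"
    unfolding intensity_def by (subst emeasure_density) auto
  also have "\<dots> = (\<integral>\<^sup>+y. ennreal (\<theta> * \<alpha> * y powr (- \<alpha> - 1)) * indicator {x..} y \<partial>lborel)"
    using AE_lborel_singleton[of x] \<open>0 < x\<close>
    by (intro nn_integral_cong_AE) (auto elim!: eventually_mono simp: indicator_def)
  also have "\<dots> = ennreal (0 - (- \<theta> * x powr (- \<alpha>)))"
  proof (rule nn_integral_FTC_atLeast)
    fix y
    assume "x \<le> y"
    with \<open>0 < x\<close> show "((\<lambda>y. - \<theta> * y powr (- \<alpha>)) has_real_derivative \<theta> * \<alpha> * y powr (- \<alpha> - 1)) (at y)"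
      by (auto intro!: derivative_eq_intros)
  next
    have "((\<lambda>y. - \<theta> * y powr (- \<alpha>)) \<longlongrightarrow> - \<theta> * 0) at_top"
      using \<open>0 < \<alpha>\<close> by (intro tendsto_intros tendsto_neg_powr filterlim_ident) auto
    then show "((\<lambda>y. - \<theta> * y powr (- \<alpha>)) \<longlongrightarrow> 0) at_top"
      by simp
  qed (use assms in auto)
  finally show ?thesis
    by simp
qed

lemma emeasure_intensity_nonpos: "emeasure (intensity \<theta> \<alpha>) {..0} = 0"
  unfolding intensity_def
  by (subst emeasure_density) (auto simp: nn_integral_0_iff_AE indicator_def)

lemma suminf_geometric_finite:
  assumes "0 \<le> c" "0 \<le> q" "q < 1" and le: "\<And>k. f k \<le> c * q ^ k"
  shows "(\<Sum>k. ennreal (f k)) < \<top>"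
proof -
  have "(\<Sum>k. ennreal (f k)) \<le> (\<Sum>k. ennreal (c * q ^ k))"
    by (intro suminf_le summableI ennreal_leI le)
  also have "\<dots> = ennreal (c * (1 / (1 - q)))"
    using assms by (intro suminf_ennreal_eq sums_mult geometric_sums) auto
  finally show ?thesis
    by (simp add: le_less_trans)
qed

locale power_law_points = prob_space M for M :: "'w measure" +
  fixes P :: "nat \<Rightarrow> 'w \<Rightarrow> real" and \<theta> \<alpha> :: real
  assumes P_meas [measurable]: "\<And>i. P i \<in> borel_measurable M"
    and \<alpha>: "1 < \<alpha>" "\<alpha> < 2" and \<theta>: "0 < \<theta>"
    and ppp: "poisson_point_process M (intensity \<theta> \<alpha>) (\<lambda>\<omega>. sum_dirac (\<lambda>i. P i \<omega>))"
begin

definition count :: "real \<Rightarrow> 'w \<Rightarrow> ennreal" where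
  "count x \<omega> = count_above (\<lambda>i. P i \<omega>) x"

lemma count_meas [measurable]: "count x \<in> borel_measurable M"
  unfolding count_def count_above_def by measurable

lemma prob_count:
  assumes "0 < x"
  shows "prob {\<omega> \<in> space M. count x \<omega> = of_nat k}
           = exp (- (\<theta> * x powr (- \<alpha>))) * (\<theta> * x powr (- \<alpha>)) ^ k / fact k"
proof -
  have "{x<..} \<in> sets (intensity \<theta> \<alpha>)"
    by (simp add: intensity_def)
  moreover have "emeasure (intensity \<theta> \<alpha>) {x<..} = ennreal (\<theta> * x powr (- \<alpha>))"
    using assms \<alpha> \<theta> by (intro emeasure_intensity_greaterThan) auto
  moreover from this have "measure (intensity \<theta> \<alpha>) {x<..} = \<theta> * x powr (- \<alpha>)"
    using \<theta> by (simp add: measure_def)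
  moreover have "count x = (\<lambda>\<omega>. emeasure (sum_dirac (\<lambda>i. P i \<omega>)) {x<..})"
    by (simp add: emeasure_sum_dirac count_def count_above_def fun_eq_iff)
  ultimately show ?thesis
    using ppp unfolding poisson_point_process_def by simp
qed

text \<open>
  The number of points in \<open>(-\<infinity>, 0]\<close> is Poisson of rate zero.
\<close>

lemma AE_points_pos: "AE \<omega> in M. \<forall>i. 0 < P i \<omega>"
proof -
  define C where "C = (\<lambda>\<omega>. \<Sum>i. indicator {..0} (P i \<omega>) :: ennreal)"
  have [measurable]: "C \<in> borel_measurable M"
    unfolding C_def by measurable
  have "{..0} \<in> sets (intensity \<theta> \<alpha>)"
    by (simp add: intensity_def)
  moreover have "measure (intensity \<theta> \<alpha>) {..0} = 0"
    using emeasure_intensity_nonpos[of \<theta> \<alpha>] by (simp add: measure_def)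
  moreover have "C = (\<lambda>\<omega>. emeasure (sum_dirac (\<lambda>i. P i \<omega>)) {..0})"
    by (simp add: emeasure_sum_dirac C_def fun_eq_iff)
  ultimately have "\<forall>k::nat. prob {\<omega> \<in> space M. C \<omega> = of_nat k} = exp (- 0) * 0 ^ k / fact k"
    using ppp emeasure_intensity_nonpos[of \<theta> \<alpha>] unfolding poisson_point_process_def by simp
  then have "prob {\<omega> \<in> space M. C \<omega> = of_nat 0} = exp (- 0) * 0 ^ 0 / fact 0"
    by (rule spec)
  then have "prob {\<omega> \<in> space M. C \<omega> = 0} = 1"
    by simp
  then have "AE \<omega> in M. C \<omega> = 0"
    by (subst (asm) prob_Collect_eq_1) auto
  then show ?thesis
  proof eventually_elim
    case (elim \<omega>)
    show ?case
    proof (rule allI, rule ccontr)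
      fix i
      assume "\<not> 0 < P i \<omega>"
      then have "1 \<le> C \<omega>"
        using ennreal_le_suminf[of "\<lambda>i. indicator {..0} (P i \<omega>)" i] by (simp add: C_def)
      with elim show False
        by simp
    qed
  qed
qed

text \<open>
  The mean of \<open>count ((1/2) ^ Suc k)\<close>.
\<close>

definition rate :: "nat \<Rightarrow> real" where
  "rate k = \<theta> * ((1/2) ^ Suc k) powr (- \<alpha>)"

lemma rate_pos: "0 < rate k"
  using \<theta> by (simp add: rate_def)

text \<open>
  The levels are below one, so the normalised counts of small points have uniformly bounded fourth
  moments.
\<close>

lemma rate_ge: "\<theta> \<le> rate k"
proof -
  have "1 \<le> ((1/2) ^ Suc k) powr (- \<alpha>)"
    using \<alpha> powr_mono'[of "- \<alpha>" 0 "(1/2) ^ Suc k"] by (simp add: power_le_one del: power_Suc)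
  then show ?thesis
    using \<theta> by (simp add: rate_def)
qed

text \<open>
  The level \<open>2 ^ k\<close> contributes a multiple of \<open>2 powr ((1 - \<alpha>) * k)\<close>. The geometric series
  converges because \<open>\<alpha> > 1\<close>.
\<close>

lemma large_points_finite:
  "(\<integral>\<^sup>+\<omega>. (\<Sum>i. ennreal (P i \<omega>) * indicator {1<..} (P i \<omega>)) \<partial>M) < \<top>"
proof -
  have "(\<integral>\<^sup>+\<omega>. (\<Sum>i. ennreal (P i \<omega>) * indicator {1<..} (P i \<omega>)) \<partial>M)
      \<le> (\<integral>\<^sup>+\<omega>. (\<Sum>k. ennreal (2 ^ Suc k) * count (2 ^ k) \<omega>) \<partial>M)"
    unfolding count_def by (intro nn_integral_mono suminf_large_points_le)
  also have "\<dots> = (\<Sum>k. ennreal (2 ^ Suc k) * (\<integral>\<^sup>+\<omega>. count (2 ^ k) \<omega> \<partial>M))"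
    by (subst nn_integral_suminf) (auto simp: nn_integral_cmult)
  also have "\<dots> = (\<Sum>k. ennreal (2 ^ Suc k) * ennreal (\<theta> * (2 ^ k) powr (- \<alpha>)))"
  proof (intro suminf_cong arg_cong2[where f="(*)"] refl)
    fix k :: nat
    show "(\<integral>\<^sup>+\<omega>. count (2 ^ k) \<omega> \<partial>M) = ennreal (\<theta> * (2 ^ k) powr (- \<alpha>))"
      using \<theta> by (intro nn_integral_poisson_mean prob_count) auto
  qed
  also have "\<dots> = (\<Sum>k. ennreal (2 ^ Suc k * (\<theta> * (2 ^ k) powr (- \<alpha>))))"
    using \<theta> by (intro suminf_cong ennreal_mult[symmetric]) auto
  also have "\<dots> < \<top>"
  proof (rule suminf_geometric_finite[of "2 * \<theta>" "2 powr (1 - \<alpha>)"])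
    fix k :: nat
    have "(2 powr (1 - \<alpha>)) ^ k = 2 ^ k * (2 ^ k) powr (- \<alpha>)"
      by (simp add: powr_realpow[symmetric] powr_powr powr_power powr_add[symmetric] algebra_simps)
    then show "2 ^ Suc k * (\<theta> * (2 ^ k) powr (- \<alpha>)) \<le> 2 * \<theta> * (2 powr (1 - \<alpha>)) ^ k"
      by simp
  next
    show "2 powr (1 - \<alpha>) < 1"
      using \<alpha> powr_less_mono[of "1 - \<alpha>" 0 2] by simp
  qed (use \<theta> in auto)
  finally show ?thesis .
qed

text \<open>
  The level \<open>(1/2) ^ Suc k\<close> contributes a multiple of \<open>2 powr ((\<alpha> - 2) * k)\<close>. The geometric series
  converges because \<open>\<alpha> < 2\<close>.
\<close>

lemma weights_finite: "(\<Sum>k. ennreal ((1/4) ^ k * rate k)) < \<top>"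
proof (rule suminf_geometric_finite[of "\<theta> * 2 powr \<alpha>" "2 powr (\<alpha> - 2)"])
  fix k :: nat
  have "((1/2) ^ Suc k) powr (- \<alpha>) = (2 powr - real (Suc k)) powr (- \<alpha>)"
    by (simp add: powr_minus powr_realpow power_one_over inverse_eq_divide del: power_Suc of_nat_Suc)
  also have "\<dots> = 2 powr \<alpha> * 2 powr (\<alpha> * k)"
    by (simp add: powr_powr powr_add[symmetric] algebra_simps)
  finally have 1: "((1/2) ^ Suc k) powr (- \<alpha>) = 2 powr \<alpha> * 2 powr (\<alpha> * k)" .
  have "(2 powr (\<alpha> - 2)) ^ k = (2 powr \<alpha>) ^ k / (2 powr 2) ^ k"
    by (simp add: powr_diff power_divide)
  also have "(2 powr \<alpha>) ^ k = 2 powr (\<alpha> * k)"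
    by (simp add: powr_power mult.commute)
  finally have "(2 powr (\<alpha> - 2)) ^ k = (1/4) ^ k * 2 powr (\<alpha> * k)"
    by (simp add: power_one_over)
  then show "(1/4) ^ k * rate k \<le> \<theta> * 2 powr \<alpha> * (2 powr (\<alpha> - 2)) ^ k"
    by (simp add: rate_def 1 del: power_Suc)
next
  show "2 powr (\<alpha> - 2) < 1"
    using \<alpha> powr_less_mono[of "\<alpha> - 2" 0 2] by simp
qed (use \<theta> in auto)

lemma small_squares_finite:
  "AE \<omega> in M. (\<Sum>i. ennreal ((P i \<omega>)\<^sup>2) * indicator {..1} (P i \<omega>)) \<noteq> \<top>"
proof -
  have "(\<integral>\<^sup>+\<omega>. (\<Sum>k. ennreal ((1/4) ^ k) * count ((1/2) ^ Suc k) \<omega>) \<partial>M)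
      = (\<Sum>k. ennreal ((1/4) ^ k) * (\<integral>\<^sup>+\<omega>. count ((1/2) ^ Suc k) \<omega> \<partial>M))"
    by (subst nn_integral_suminf) (auto simp: nn_integral_cmult)
  also have "\<dots> = (\<Sum>k. ennreal ((1/4) ^ k) * ennreal (rate k))"
  proof (intro suminf_cong arg_cong2[where f="(*)"] refl)
    fix k :: nat
    show "(\<integral>\<^sup>+\<omega>. count ((1/2) ^ Suc k) \<omega> \<partial>M) = ennreal (rate k)"
      using rate_pos[of k] unfolding rate_def by (intro nn_integral_poisson_mean prob_count) auto
  qed
  also have "\<dots> = (\<Sum>k. ennreal ((1/4) ^ k * rate k))"
    using rate_pos by (intro suminf_cong ennreal_mult[symmetric]) (auto intro: less_imp_le)
  also have "\<dots> < \<infinity>"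
    using weights_finite by simp
  finally have "AE \<omega> in M. (\<Sum>k. ennreal ((1/4) ^ k) * count ((1/2) ^ Suc k) \<omega>) \<noteq> \<infinity>"
    by (intro nn_integral_PInf_AE) auto
  with AE_points_pos show ?thesis
  proof eventually_elim
    case (elim \<omega>)
    then show ?case
      using suminf_small_squares_le[of "\<lambda>i. P i \<omega>"] by (auto simp: count_def top_unique)
  qed
qed

text \<open>
  The sum of the large points is almost surely finite and dominates each of them, hence it controls
  the sum of their squares. The cubes are then dominated through \<open>p \<le> 1 + p\<^sup>2 \<le> 1 + (\<Sum> p\<^sup>2)\<close>.
\<close>

lemma AE_sums_finite:
  "AE \<omega> in M. (\<Sum>i. ennreal ((P i \<omega>)\<^sup>2)) \<noteq> \<top> \<and> (\<Sum>i. ennreal (P i \<omega> ^ 3)) \<noteq> \<top>"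
proof -
  have "AE \<omega> in M. (\<Sum>i. ennreal (P i \<omega>) * indicator {1<..} (P i \<omega>)) \<noteq> \<infinity>"
    using large_points_finite by (intro nn_integral_PInf_AE) auto
  with AE_points_pos small_squares_finite show ?thesis
  proof eventually_elim
    case (elim \<omega>)
    define p where "p = (\<lambda>i. P i \<omega>)"
    define A where "A = (\<Sum>i. ennreal ((p i)\<^sup>2) * indicator {..1} (p i))"
    define B where "B = (\<Sum>i. ennreal (p i) * indicator {1<..} (p i))"
    define S where "S = (\<Sum>i. ennreal ((p i)\<^sup>2))"
    have pos: "0 < p i" for i
      using elim by (simp add: p_def)
    have B_ge: "ennreal (p i) * indicator {1<..} (p i) \<le> B" for i
      unfolding B_def by (rule ennreal_le_suminf)
    have "S = (\<Sum>i. ennreal ((p i)\<^sup>2) * indicator {..1} (p i) + ennreal ((p i)\<^sup>2) * indicator {1<..} (p i))"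
      unfolding S_def by (intro suminf_cong) (auto simp: indicator_def)
    also have "\<dots> \<le> (\<Sum>i. ennreal ((p i)\<^sup>2) * indicator {..1} (p i)
        + B * (ennreal (p i) * indicator {1<..} (p i)))"
    proof (intro suminf_le summableI add_left_mono)
      fix i
      show "ennreal ((p i)\<^sup>2) * indicator {1<..} (p i) \<le> B * (ennreal (p i) * indicator {1<..} (p i))"
        using B_ge[of i] pos[of i]
        by (auto simp: indicator_def power2_eq_square ennreal_mult less_imp_le intro!: mult_right_mono)
    qed
    also have "\<dots> = A + B * B"
      by (simp add: A_def B_def suminf_add[OF summableI summableI, symmetric])
    also have "\<dots> < \<top>"
      using elim by (simp add: A_def B_def p_def ennreal_mult_less_top less_top)
    finally have S: "S < \<top>" .
    have "(\<Sum>i. ennreal (p i ^ 3)) \<le> (\<Sum>i. (1 + S) * ennreal ((p i)\<^sup>2))"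
    proof (intro suminf_le summableI)
      fix i
      have "ennreal (p i) \<le> ennreal (1 + (p i)\<^sup>2)"
        using zero_le_power2[of "p i - 1/2"] by (intro ennreal_leI) (simp add: power2_eq_square algebra_simps)
      also have "\<dots> = 1 + ennreal ((p i)\<^sup>2)"
        by simp
      also have "\<dots> \<le> 1 + S"
        unfolding S_def by (intro add_left_mono ennreal_le_suminf)
      finally have "ennreal (p i) * ennreal ((p i)\<^sup>2) \<le> (1 + S) * ennreal ((p i)\<^sup>2)"
        by (rule mult_right_mono) simp
      then show "ennreal (p i ^ 3) \<le> (1 + S) * ennreal ((p i)\<^sup>2)"
        using pos[of i] by (simp add: ennreal_mult[symmetric] power2_eq_square power3_eq_cube mult.assoc less_imp_le)
    qed
    also have "\<dots> = (1 + S) * S"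
      by (simp add: S_def)
    also have "\<dots> < \<top>"
      using S by (simp add: ennreal_mult_less_top)
    finally show ?case
      using S by (simp add: S_def p_def)
  qed
qed

text \<open>
  The probability that no point exceeds \<open>(1/2) ^ k\<close> is \<open>exp (- \<theta> * 2 powr (\<alpha> * k))\<close>. It decays fast
  enough to compensate the factor \<open>64 ^ Suc k\<close>.
\<close>

lemma inverse_cubes_moment:
  "(\<integral>\<^sup>+\<omega>. (inverse (\<Sum>i. ennreal (P i \<omega> ^ 3)))\<^sup>2 \<partial>M) < \<top>"
proof -
  have "(\<integral>\<^sup>+\<omega>. (inverse (\<Sum>i. ennreal (P i \<omega> ^ 3)))\<^sup>2 \<partial>M)
      \<le> (\<integral>\<^sup>+\<omega>. 1 + (\<Sum>k. ennreal (64 ^ Suc k) * indicator {0} (count ((1/2) ^ k) \<omega>)) \<partial>M)"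
    using AE_points_pos
  proof (intro nn_integral_mono_AE, eventually_elim)
    case (elim \<omega>)
    then show ?case
      using inverse_sum_cubes_le[of "\<lambda>i. P i \<omega>"] by (simp add: count_def)
  qed
  also have "\<dots> = 1 + (\<Sum>k. ennreal (64 ^ Suc k) * (\<integral>\<^sup>+\<omega>. indicator {0} (count ((1/2) ^ k) \<omega>) \<partial>M))"
    by (subst nn_integral_add) (auto simp: nn_integral_suminf nn_integral_cmult emeasure_space_1)
  also have "(\<Sum>k. ennreal (64 ^ Suc k) * (\<integral>\<^sup>+\<omega>. indicator {0} (count ((1/2) ^ k) \<omega>) \<partial>M))
      = (\<Sum>k. ennreal (64 ^ Suc k * exp (- (\<theta> * ((1/2) ^ k) powr (- \<alpha>)))))"
  proof (intro suminf_cong)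
    fix k :: nat
    have "(\<integral>\<^sup>+\<omega>. indicator {0} (count ((1/2) ^ k) \<omega>) \<partial>M)
        = (\<integral>\<^sup>+\<omega>. indicator {\<omega> \<in> space M. count ((1/2) ^ k) \<omega> = of_nat 0} \<omega> \<partial>M)"
      by (intro nn_integral_cong) (auto simp: indicator_def)
    also have "\<dots> = ennreal (exp (- (\<theta> * ((1/2) ^ k) powr (- \<alpha>))))"
      using prob_count[of "(1/2) ^ k" 0] by (subst nn_integral_indicator) (auto simp: emeasure_eq_measure)
    finally show "ennreal (64 ^ Suc k) * (\<integral>\<^sup>+\<omega>. indicator {0} (count ((1/2) ^ k) \<omega>) \<partial>M)
        = ennreal (64 ^ Suc k * exp (- (\<theta> * ((1/2) ^ k) powr (- \<alpha>))))"
      by (simp add: ennreal_mult)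
  qed
  also have "\<dots> < \<top>"
  \<comment> \<open>Since \<open>\<alpha> > 1\<close>, the exponent is at least \<open>u = \<theta> * 2 ^ k\<close>. The bound \<open>exp (- u) \<le> (7 / u) ^ 7\<close>
      brings a factor \<open>128 = 2 ^ 7\<close> per level, the first power of two that beats \<open>64\<close>.\<close>
  proof (rule suminf_geometric_finite[of "64 * (7 / \<theta>) ^ 7" "1/2"])
    fix k :: nat
    define u where "u = \<theta> * 2 ^ k"
    have "2 ^ k = ((1/2 :: real) ^ k) powr (- 1)"
      by (simp add: powr_minus_divide power_one_over)
    also have "\<dots> \<le> ((1/2) ^ k) powr (- \<alpha>)"
      using \<alpha> by (intro powr_mono') (auto simp: power_le_one)
    finally have "exp (- (\<theta> * ((1/2) ^ k) powr (- \<alpha>))) \<le> exp (- u)"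
      using \<theta> by (simp add: u_def)
    also have "\<dots> \<le> (7 / u) ^ 7"
    proof -
      have "0 < u"
        using \<theta> by (simp add: u_def)
      have "(u / 7) ^ 7 \<le> exp (u / 7) ^ 7"
        using exp_ge_add_one_self[of "u / 7"] \<open>0 < u\<close> by (intro power_mono) (linarith, simp)
      also have "\<dots> = exp u"
        by (simp add: exp_of_nat_mult[symmetric])
      finally have "inverse (exp u) \<le> inverse ((u / 7) ^ 7)"
        using \<open>0 < u\<close> by (intro le_imp_inverse_le) auto
      then show ?thesis
        by (simp add: exp_minus power_inverse[symmetric])
    qed
    also have "(7 / u) ^ 7 = (7 / \<theta>) ^ 7 * (1 / 128) ^ k"
      by (simp add: u_def power_divide power_mult_distrib power_mult[symmetric] mult.commute[of k 7])
         (simp add: power_mult)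
    finally have "64 ^ Suc k * exp (- (\<theta> * ((1/2) ^ k) powr (- \<alpha>)))
        \<le> 64 ^ Suc k * ((7 / \<theta>) ^ 7 * (1 / 128) ^ k)"
      by (intro mult_left_mono) auto
    also have "\<dots> = 64 * (7 / \<theta>) ^ 7 * (64 * (1 / 128)) ^ k"
      unfolding power_mult_distrib by (simp add: mult_ac)
    finally show "64 ^ Suc k * exp (- (\<theta> * ((1/2) ^ k) powr (- \<alpha>))) \<le> 64 * (7 / \<theta>) ^ 7 * (1/2) ^ k"
      by simp
  qed (use \<theta> in auto)
  finally show ?thesis
    by (simp add: less_top[symmetric])
qed

text \<open>
  Taking expectations in \<open>square_ratio_le\<close> with \<open>l = rate\<close>: each of the resulting terms is finite.
\<close>

lemma ratio_finite:
  "(\<integral>\<^sup>+\<omega>. (\<Sum>i. ennreal ((P i \<omega>)\<^sup>2))\<^sup>2 / (\<Sum>i. ennreal (P i \<omega> ^ 3)) \<partial>M) < \<top>"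
proof -
  define w where "w = (\<lambda>k. ennreal ((1/4) ^ k * rate k))"
  define x where "x = (\<lambda>k \<omega>. count ((1/2) ^ Suc k) \<omega> / ennreal (rate k))"
  define J where "J = (\<lambda>\<omega>. (inverse (\<Sum>i. ennreal (P i \<omega> ^ 3)))\<^sup>2)"
  define B where "B = (\<lambda>\<omega>. \<Sum>i. ennreal (P i \<omega>) * indicator {1<..} (P i \<omega>))"
  define C where "C = ennreal (256 * exp (exp (1 / \<theta>)))"
  have [measurable]: "x k \<in> borel_measurable M" "J \<in> borel_measurable M" "B \<in> borel_measurable M" for k
    unfolding x_def J_def B_def by measurable
  have x4: "(\<integral>\<^sup>+\<omega>. (x k \<omega>) ^ 4 \<partial>M) \<le> C" for k
  proof -
    have "(\<integral>\<^sup>+\<omega>. (x k \<omega>) ^ 4 \<partial>M)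
        = (\<integral>\<^sup>+\<omega>. (count ((1/2) ^ Suc k) \<omega>) ^ 4 * inverse (ennreal (rate k)) ^ 4 \<partial>M)"
      by (simp add: x_def divide_ennreal_def power_mult_distrib)
    also have "\<dots> = (\<integral>\<^sup>+\<omega>. (count ((1/2) ^ Suc k) \<omega>) ^ 4 \<partial>M) * inverse (ennreal (rate k)) ^ 4"
      by (rule nn_integral_multc) simp
    also have "\<dots> \<le> ennreal (256 * exp (exp (1 / rate k)) * rate k ^ 4) * inverse (ennreal (rate k)) ^ 4"
      using rate_pos[of k] unfolding rate_def
      by (intro mult_right_mono nn_integral_poisson_fourth_moment prob_count) auto
    also have "\<dots> = ennreal (256 * exp (exp (1 / rate k)))"
      using rate_pos[of k]
      by (simp add: inverse_ennreal ennreal_power ennreal_mult[symmetric] power_inverse)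
    also have "\<dots> \<le> C"
      unfolding C_def using rate_ge[of k] \<theta> by (intro ennreal_leI) (simp add: frac_le)
    finally show ?thesis .
  qed
  have "(\<integral>\<^sup>+\<omega>. (\<Sum>i. ennreal ((P i \<omega>)\<^sup>2))\<^sup>2 / (\<Sum>i. ennreal (P i \<omega> ^ 3)) \<partial>M)
      \<le> (\<integral>\<^sup>+\<omega>. 2 * B \<omega> + 2 * ((\<Sum>k. w k) * (\<Sum>k. w k * ((x k \<omega>) ^ 4 + J \<omega>))) \<partial>M)"
    using AE_points_pos AE_sums_finite
  proof (intro nn_integral_mono_AE, eventually_elim)
    case (elim \<omega>)
    then show ?case
      using square_ratio_le[of "\<lambda>i. P i \<omega>" rate] rate_pos
      unfolding B_def w_def x_def J_def count_def by simp
  qed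
  also have "\<dots> = 2 * (\<integral>\<^sup>+\<omega>. B \<omega> \<partial>M) + 2 * ((\<Sum>k. w k) * (\<Sum>k. w k * ((\<integral>\<^sup>+\<omega>. (x k \<omega>) ^ 4 \<partial>M) + (\<integral>\<^sup>+\<omega>. J \<omega> \<partial>M))))"
    by (simp add: nn_integral_add nn_integral_cmult nn_integral_suminf)
  also have "\<dots> \<le> 2 * (\<integral>\<^sup>+\<omega>. B \<omega> \<partial>M) + 2 * ((\<Sum>k. w k) * (\<Sum>k. w k * (C + (\<integral>\<^sup>+\<omega>. J \<omega> \<partial>M))))"
    by (intro add_left_mono mult_left_mono suminf_le summableI add_right_mono x4) auto
  also have "\<dots> = 2 * (\<integral>\<^sup>+\<omega>. B \<omega> \<partial>M) + 2 * ((\<Sum>k. w k) * ((\<Sum>k. w k) * (C + (\<integral>\<^sup>+\<omega>. J \<omega> \<partial>M))))"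
    by (simp only: ennreal_suminf_multc)
  also have "\<dots> < \<top>"
    using large_points_finite weights_finite inverse_cubes_moment
    by (simp add: B_def w_def J_def C_def ennreal_mult_less_top)
  finally show ?thesis .
qed

lemma AE_summable_powers:
  "AE \<omega> in M. (\<forall>i. 0 < P i \<omega>) \<and> summable (\<lambda>i. (P i \<omega>)\<^sup>2) \<and> summable (\<lambda>i. P i \<omega> ^ 3)"
  using AE_points_pos AE_sums_finite
proof eventually_elim
  case (elim \<omega>)
  then have "0 \<le> P i \<omega>" for i
    by (simp add: less_imp_le)
  with elim show ?case
    by (intro conjI summable_suminf_not_top) auto
qed

lemma integrable_square_ratio:
  "integrable M (\<lambda>\<omega>. (\<Sum>i. (P i \<omega>)\<^sup>2)\<^sup>2 / (\<Sum>i. P i \<omega> ^ 3))"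
proof (rule integrableI_bounded)
  have "(\<integral>\<^sup>+\<omega>. ennreal (norm ((\<Sum>i. (P i \<omega>)\<^sup>2)\<^sup>2 / (\<Sum>i. P i \<omega> ^ 3))) \<partial>M)
      = (\<integral>\<^sup>+\<omega>. (\<Sum>i. ennreal ((P i \<omega>)\<^sup>2))\<^sup>2 / (\<Sum>i. ennreal (P i \<omega> ^ 3)) \<partial>M)"
    using AE_summable_powers
  proof (intro nn_integral_cong_AE, eventually_elim)
    case (elim \<omega>)
    then have "0 \<le> P i \<omega>" for i
      by (simp add: less_imp_le)
    moreover have "0 < (\<Sum>i. P i \<omega> ^ 3)"
      using elim by (intro suminf_pos) auto
    ultimately show ?case
      using elim
      by (simp add: suminf_ennreal2 divide_ennreal[symmetric] ennreal_power suminf_nonneg)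
  qed
  also have "\<dots> < \<infinity>"
    using ratio_finite by simp
  finally show "(\<integral>\<^sup>+\<omega>. ennreal (norm ((\<Sum>i. (P i \<omega>)\<^sup>2)\<^sup>2 / (\<Sum>i. P i \<omega> ^ 3))) \<partial>M) < \<infinity>" .
qed simp

end

section \<open>Gaussian scale mixtures\<close>

text \<open>
  Disintegration along independence: if \<open>k \<omega>\<close> is the density of \<open>H\<close> with its first argument frozen
  at \<open>X \<omega>\<close>, then the density of \<open>H\<close> is the average of these conditional densities. The frozen
  variable and the remaining randomness may live on the same space, since only the product of
  their laws enters.
\<close>

lemma (in prob_space) distributed_mixture:
  fixes H :: "'b \<times> 'b \<Rightarrow> real"
  assumes indep: "indep_var S X T Y"
    and H [measurable]: "H \<in> borel_measurable (S \<Otimes>\<^sub>M T)"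
    and k [measurable]: "(\<lambda>(\<omega>, x). k \<omega> x) \<in> borel_measurable (M \<Otimes>\<^sub>M lborel)"
    and cond: "AE \<omega> in M. distributed M lborel (\<lambda>\<omega>'. H (X \<omega>, Y \<omega>')) (k \<omega>)"
  shows "distributed M lborel (\<lambda>\<omega>. H (X \<omega>, Y \<omega>)) (\<lambda>x. \<integral>\<^sup>+\<omega>. k \<omega> x \<partial>M)"
proof -
  have X [measurable]: "X \<in> measurable M S" and Y [measurable]: "Y \<in> measurable M T"
    using indep by (auto dest: indep_var_rv1 indep_var_rv2)
  have joint: "distr M S X \<Otimes>\<^sub>M distr M T Y = distr M (S \<Otimes>\<^sub>M T) (\<lambda>\<omega>. (X \<omega>, Y \<omega>))"
    using indep by (simp add: indep_var_distribution_eq)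
  interpret Y: prob_space "distr M T Y"
    by (rule prob_space_distr) simp
  interpret MM: pair_sigma_finite M lborel ..
  have "distr M lborel (\<lambda>\<omega>. H (X \<omega>, Y \<omega>)) = density lborel (\<lambda>x. \<integral>\<^sup>+\<omega>. k \<omega> x \<partial>M)"
  proof (rule measure_eqI)
    fix B
    assume "B \<in> sets (distr M lborel (\<lambda>\<omega>. H (X \<omega>, Y \<omega>)))"
    then have B [measurable]: "B \<in> sets borel"
      by simp
    have "emeasure (distr M lborel (\<lambda>\<omega>. H (X \<omega>, Y \<omega>))) B
        = (\<integral>\<^sup>+\<omega>. indicator B (H (X \<omega>, Y \<omega>)) \<partial>M)"
      by (subst nn_integral_indicator[symmetric], simp, subst nn_integral_distr) auto
    also have "\<dots> = (\<integral>\<^sup>+z. indicator B (H z) \<partial>(distr M S X \<Otimes>\<^sub>M distr M T Y))"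
      unfolding joint by (subst nn_integral_distr) auto
    also have "\<dots> = (\<integral>\<^sup>+s. \<integral>\<^sup>+t. indicator B (H (s, t)) \<partial>distr M T Y \<partial>distr M S X)"
      by (subst Y.nn_integral_fst[symmetric]) auto
    also have "\<dots> = (\<integral>\<^sup>+\<omega>. \<integral>\<^sup>+t. indicator B (H (X \<omega>, t)) \<partial>distr M T Y \<partial>M)"
      by (subst nn_integral_distr) auto
    also have "\<dots> = (\<integral>\<^sup>+\<omega>. \<integral>\<^sup>+x. k \<omega> x * indicator B x \<partial>lborel \<partial>M)"
      using cond AE_space[of M]
    proof (intro nn_integral_cong_AE, eventually_elim)
      case (elim \<omega>)
      then have [simp]: "X \<omega> \<in> space S"
        using measurable_space[OF X] by simp
      have [measurable]: "k \<omega> \<in> borel_measurable lborel"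
        using elim by (auto simp: distributed_def)
      have "(\<integral>\<^sup>+t. indicator B (H (X \<omega>, t)) \<partial>distr M T Y) = (\<integral>\<^sup>+\<omega>'. indicator B (H (X \<omega>, Y \<omega>')) \<partial>M)"
        by (subst nn_integral_distr) auto
      also have "\<dots> = (\<integral>\<^sup>+x. indicator B x \<partial>distr M lborel (\<lambda>\<omega>'. H (X \<omega>, Y \<omega>')))"
        by (subst nn_integral_distr) auto
      also have "distr M lborel (\<lambda>\<omega>'. H (X \<omega>, Y \<omega>')) = density lborel (k \<omega>)"
        using elim by (simp add: distributed_def)
      also have "(\<integral>\<^sup>+x. indicator B x \<partial>density lborel (k \<omega>)) = (\<integral>\<^sup>+x. k \<omega> x * indicator B x \<partial>lborel)"
        by (subst nn_integral_density) auto
      finally show ?case .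
    qed
    also have "\<dots> = (\<integral>\<^sup>+x. \<integral>\<^sup>+\<omega>. k \<omega> x * indicator B x \<partial>M \<partial>lborel)"
      by (intro MM.Fubini'[symmetric]) simp
    also have "\<dots> = (\<integral>\<^sup>+x. (\<integral>\<^sup>+\<omega>. k \<omega> x \<partial>M) * indicator B x \<partial>lborel)"
      by (intro nn_integral_cong nn_integral_multc) auto
    also have "\<dots> = emeasure (density lborel (\<lambda>x. \<integral>\<^sup>+\<omega>. k \<omega> x \<partial>M)) B"
      by (subst emeasure_density) auto
    finally show "emeasure (distr M lborel (\<lambda>\<omega>. H (X \<omega>, Y \<omega>))) B
        = emeasure (density lborel (\<lambda>x. \<integral>\<^sup>+\<omega>. k \<omega> x \<partial>M)) B" .
  qed simp
  then show ?thesis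
    by (auto simp: distributed_def)
qed

lemma abs_mult_std_normal_density_le: "\<bar>u\<bar> * std_normal_density u \<le> 1"
proof -
  have "1 * 1 \<le> sqrt 2 * sqrt pi"
    using pi_ge_two by (intro mult_mono) auto
  moreover have "\<bar>u\<bar> * exp (- u\<^sup>2 / 2) \<le> 1"
  proof -
    have "2 * \<bar>u\<bar> \<le> 1 + u\<^sup>2"
      using zero_le_power2[of "\<bar>u\<bar> - 1"] by (simp add: power2_eq_square algebra_simps)
    then have "\<bar>u\<bar> \<le> exp (u\<^sup>2 / 2)"
      using exp_ge_add_one_self[of "u\<^sup>2 / 2"] by linarith
    then show ?thesis
      by (simp add: exp_minus field_simps)
  qed
  ultimately have "\<bar>u\<bar> * exp (- u\<^sup>2 / 2) \<le> sqrt 2 * sqrt pi"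
    by linarith
  then show ?thesis
    by (simp add: std_normal_density_def real_sqrt_mult field_simps)
qed

text \<open>
  With \<open>\<phi>\<close> the standard normal density, the \<open>x\<close>-derivative of \<open>r * \<phi> (r * x)\<close> is
  \<open>- r\<^sup>2 * (r * x) * \<phi> (r * x)\<close>. As \<open>u * \<phi> u\<close> is bounded by \<open>1\<close>, this derivative, and by the mean value
  theorem also every difference quotient, is bounded by \<open>r\<^sup>2\<close> uniformly in \<open>x\<close>. A finite second
  moment of \<open>r\<close> therefore lets dominated convergence pass the derivative, and the continuity of the
  derivative, through the expectation.
\<close>

lemma (in prob_space) normal_scale_mixture_C1:
  fixes r :: "'a \<Rightarrow> real"
  assumes [measurable]: "r \<in> borel_measurable M" and sq: "integrable M (\<lambda>\<omega>. (r \<omega>)\<^sup>2)"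
  defines "f \<equiv> \<lambda>x. expectation (\<lambda>\<omega>. r \<omega> * std_normal_density (r \<omega> * x))"
  shows "f C1_differentiable_on UNIV"
    and "\<And>x. integrable M (\<lambda>\<omega>. r \<omega> * std_normal_density (r \<omega> * x))"
proof -
  define k where "k = (\<lambda>x \<omega>. r \<omega> * std_normal_density (r \<omega> * x))"
  define k' where "k' = (\<lambda>x \<omega>. - (r \<omega>)\<^sup>2 * ((r \<omega> * x) * std_normal_density (r \<omega> * x)))"
  have [measurable]: "k x \<in> borel_measurable M" "k' x \<in> borel_measurable M" for x
    unfolding k_def k'_def by measurable
  have density_le: "std_normal_density u \<le> 1" for u
  proof -
    have "1 * 1 \<le> sqrt 2 * sqrt pi"
      using pi_ge_two by (intro mult_mono) auto
    moreover have "exp (- u\<^sup>2 / 2) \<le> 1"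
      by simp
    ultimately have "exp (- u\<^sup>2 / 2) \<le> sqrt 2 * sqrt pi"
      by linarith
    then show ?thesis
      by (simp add: std_normal_density_def real_sqrt_mult field_simps)
  qed
  show int_k: "integrable M (\<lambda>\<omega>. r \<omega> * std_normal_density (r \<omega> * x))" for x
  proof (rule Bochner_Integration.integrable_bound[OF square_integrable_imp_integrable[OF _ sq]])
    show "AE \<omega> in M. norm (r \<omega> * std_normal_density (r \<omega> * x)) \<le> norm (r \<omega>)"
      by (auto simp: abs_mult intro!: mult_left_le density_le)
  qed auto
  have k'_le: "\<bar>k' x \<omega>\<bar> \<le> (r \<omega>)\<^sup>2" for x \<omega>
    using abs_mult_std_normal_density_le[of "r \<omega> * x"]
    by (simp add: k'_def abs_mult mult_left_le)
  have deriv_k: "((\<lambda>x. k x \<omega>) has_real_derivative k' x \<omega>) (at x)" for x \<omega>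
  proof -
    \<comment> \<open>Hides the normalising constant from the simplifier, which would rationalise it.\<close>
    define c where "c = 1 / sqrt (2 * pi)"
    show ?thesis
      unfolding k_def k'_def std_normal_density_def c_def[symmetric]
      by (auto intro!: derivative_eq_intros simp: power2_eq_square)
  qed
  have lipschitz: "\<bar>(k y \<omega> - k x \<omega>) / (y - x)\<bar> \<le> (r \<omega>)\<^sup>2" for x y \<omega>
  proof -
    have "norm (k y \<omega> - k x \<omega>) \<le> (r \<omega>)\<^sup>2 * norm (y - x)"
      by (rule field_differentiable_bound[of UNIV "\<lambda>x. k x \<omega>" "\<lambda>x. k' x \<omega>"])
         (use deriv_k k'_le in auto)
    then show ?thesis
      by (cases "x = y") (auto simp: field_simps)
  qed
  have f_k: "f x = expectation (k x)" for x
    by (simp add: f_def k_def)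
  have int_k2: "integrable M (k x)" for x
    using int_k by (simp add: k_def)
  have "(f has_real_derivative expectation (k' x)) (at x)" for x
    unfolding has_field_derivative_iff tendsto_at_iff_sequentially comp_def
  proof (intro allI impI)
    fix y :: "nat \<Rightarrow> real"
    assume y: "\<forall>i. y i \<in> UNIV - {x}" "y \<longlonglongrightarrow> x"
    have "(\<lambda>i. expectation (\<lambda>\<omega>. (k (y i) \<omega> - k x \<omega>) / (y i - x))) \<longlonglongrightarrow> expectation (k' x)"
    proof (rule integral_dominated_convergence[where w="\<lambda>\<omega>. (r \<omega>)\<^sup>2"])
      show "AE \<omega> in M. (\<lambda>i. (k (y i) \<omega> - k x \<omega>) / (y i - x)) \<longlonglongrightarrow> k' x \<omega>"
        using deriv_k y unfolding has_field_derivative_iff tendsto_at_iff_sequentially comp_def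
        by blast
    qed (use sq lipschitz in auto)
    then show "(\<lambda>i. (f (y i) - f x) / (y i - x)) \<longlonglongrightarrow> expectation (k' x)"
      by (simp add: f_k int_k2)
  qed
  moreover have "continuous_on UNIV (\<lambda>x. expectation (k' x))"
    unfolding continuous_on_sequentially comp_def
  proof (intro allI impI ballI, elim conjE)
    fix y :: "nat \<Rightarrow> real" and x
    assume y: "y \<longlonglongrightarrow> x"
    show "(\<lambda>i. expectation (k' (y i))) \<longlonglongrightarrow> expectation (k' x)"
    proof (rule integral_dominated_convergence[where w="\<lambda>\<omega>. (r \<omega>)\<^sup>2"])
      show "AE \<omega> in M. (\<lambda>i. k' (y i) \<omega>) \<longlonglongrightarrow> k' x \<omega>"
        unfolding k'_def std_normal_density_def by (intro AE_I2 tendsto_intros y) auto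
    qed (use sq k'_le in auto)
  qed
  ultimately show "f C1_differentiable_on UNIV"
    unfolding C1_differentiable_on_def has_real_derivative_iff_has_vector_derivative
    by (intro exI[of _ "\<lambda>x. expectation (k' x)"]) auto
qed

lemma normal_density_inverse_scale:
  assumes "0 < r"
  shows "normal_density 0 (1 / r) x = r * std_normal_density (r * x)"
  using assms by (simp add: normal_density_def std_normal_density_def power_divide real_sqrt_divide power_mult_distrib real_sqrt_mult field_simps)

lemma (in prob_space) distributed_normal_series_scaled:
  fixes Z :: "nat \<Rightarrow> 'a \<Rightarrow> real"
  assumes Z: "iid_normal M \<sigma> Z" and "0 < \<sigma>" and a: "summable (\<lambda>i. (a i)\<^sup>2)" "0 < (\<Sum>i. (a i)\<^sup>2)"
    and "0 < c" and r: "r = 1 / (c * \<sigma> * sqrt (\<Sum>i. (a i)\<^sup>2))"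
  shows "distributed M lborel (\<lambda>\<omega>. c * (\<Sum>i. a i * Z i \<omega>)) (\<lambda>x. ennreal (r * std_normal_density (r * x)))"
proof -
  have "distributed M lborel (\<lambda>\<omega>. 0 + c * (\<Sum>i. a i * Z i \<omega>))
      (\<lambda>x. ennreal (normal_density (0 + c * 0) (\<bar>c\<bar> * (\<sigma> * sqrt (\<Sum>i. (a i)\<^sup>2))) x))"
    using assms by (intro normal_density_affine distributed_normal_series) auto
  moreover have "\<bar>c\<bar> * (\<sigma> * sqrt (\<Sum>i. (a i)\<^sup>2)) = 1 / r"
    using assms by simp
  moreover have "0 < r"
    using assms by simp
  ultimately show ?thesis
    by (simp add: normal_density_inverse_scale)
qed

section \<open>The density of the quotient\<close>

theorem proposition5p6:
  fixes \<alpha> \<mu>\<^sub>A \<sigma>\<^sub>A \<theta> :: real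
    and M :: "'a measure" and V1 V2 :: "'a \<Rightarrow> real"
    and N :: "'b measure" and P Z :: "nat \<Rightarrow> 'b \<Rightarrow> real"
  assumes "1 < \<alpha>" "\<alpha> < 2"
    and "0 < \<mu>\<^sub>A" "\<mu>\<^sub>A < 1"
    and "0 < \<sigma>\<^sub>A"
    and "\<theta> = 1 - \<mu>\<^sub>A powr \<alpha>"
    and "prob_space M" "prob_space N"
    and "V1 \<in> borel_measurable M" "V2 \<in> borel_measurable M"
    and "\<And>i. P i \<in> borel_measurable N"
    and "poisson_point_process N (intensity \<theta> \<alpha>) (\<lambda>\<omega>. sum_dirac (\<lambda>i. P i \<omega>))"
    and "AE \<omega> in N. decseq (\<lambda>i. P i \<omega>)"
    and "iid_normal N \<sigma>\<^sub>A Z"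
    and "prob_space.indep_var N
           (PiM UNIV (\<lambda>_. borel)) (\<lambda>\<omega> i. P i \<omega>)
           (PiM UNIV (\<lambda>_. borel)) (\<lambda>\<omega> i. Z i \<omega>)"
    and "distr M borel (\<lambda>\<omega>. (V1 \<omega>, V2 \<omega>)) = distr N borel (series_vector \<mu>\<^sub>A P Z)"
  shows "\<exists>f :: real \<Rightarrow> real.
           (\<forall>x. 0 \<le> f x) \<and>
           distributed M lborel (\<lambda>\<omega>. V2 \<omega> / V1 \<omega>) (\<lambda>x. ennreal (f x)) \<and>
           f C1_differentiable_on UNIV"
proof -
  interpret M: prob_space M by fact
  have "\<mu>\<^sub>A powr \<alpha> < 1"
    using assms powr_less_mono2[of \<alpha> \<mu>\<^sub>A 1] by simp
  with assms interpret power_law_points N P \<theta> \<alpha>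
    by (intro power_law_points.intro power_law_points_axioms.intro) auto
  let ?S = "PiM UNIV (\<lambda>_. borel) :: (nat \<Rightarrow> real) measure"
  define S2 where "S2 = (\<lambda>p :: nat \<Rightarrow> real. \<Sum>i. (p i)\<^sup>2)"
  define S3 where "S3 = (\<lambda>p :: nat \<Rightarrow> real. \<Sum>i. p i ^ 3)"
  define c1 where "c1 = 1 / (1 - \<mu>\<^sub>A\<^sup>2)"
  define c2 where "c2 = 1 / (1 - \<mu>\<^sub>A ^ 3) powr (1/2)"
  have "\<mu>\<^sub>A\<^sup>2 < 1" "\<mu>\<^sub>A ^ 3 < 1"
    using assms power_strict_decreasing[of 0 2 \<mu>\<^sub>A] power_strict_decreasing[of 0 3 \<mu>\<^sub>A] by auto
  then have "0 < c1" "0 < c2"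
    by (simp_all add: c1_def c2_def)
  define H where "H = (\<lambda>(p, z). (c2 * (\<Sum>i. p i powr (3/2) * z i)) / (c1 * S2 p))"
  have [measurable]: "(\<lambda>x. fst x i) \<in> borel_measurable (?S \<Otimes>\<^sub>M ?S)"
      "(\<lambda>x. snd x i) \<in> borel_measurable (?S \<Otimes>\<^sub>M ?S)" for i
    by measurable
  have H_meas: "H \<in> borel_measurable (?S \<Otimes>\<^sub>M ?S)"
    unfolding H_def S2_def case_prod_beta by measurable
  define P' where "P' = (\<lambda>\<omega> i. P i \<omega>)"
  define Z' where "Z' = (\<lambda>\<omega> i. Z i \<omega>)"
  \<comment> \<open>Given the points, the quotient is centred Gaussian with standard deviation \<open>1 / r \<omega>\<close>.\<close>
  define r where "r = (\<lambda>\<omega>. c1 * S2 (P' \<omega>) / (c2 * \<sigma>\<^sub>A * sqrt (S3 (P' \<omega>))))"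
  have r_meas [measurable]: "r \<in> borel_measurable N"
    unfolding r_def S2_def S3_def P'_def by measurable
  define f where "f = (\<lambda>x. expectation (\<lambda>\<omega>. r \<omega> * std_normal_density (r \<omega> * x)))"
  have sums_pos: "AE \<omega> in N. 0 < S2 (P' \<omega>) \<and> 0 < S3 (P' \<omega>)"
    using AE_summable_powers
  proof eventually_elim
    case (elim \<omega>)
    then show ?case
      unfolding S2_def S3_def P'_def by (intro conjI suminf_pos zero_less_power) auto
  qed
  have r_sq: "integrable N (\<lambda>\<omega>. (r \<omega>)\<^sup>2)"
  proof -
    have "AE \<omega> in N. (r \<omega>)\<^sup>2 = (c1 / (c2 * \<sigma>\<^sub>A))\<^sup>2 * ((S2 (P' \<omega>))\<^sup>2 / S3 (P' \<omega>))"
      using sums_pos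
      by eventually_elim (simp add: r_def power_divide power_mult_distrib)
    moreover have "integrable N (\<lambda>\<omega>. (c1 / (c2 * \<sigma>\<^sub>A))\<^sup>2 * ((S2 (P' \<omega>))\<^sup>2 / S3 (P' \<omega>)))"
      using integrable_square_ratio unfolding S2_def S3_def P'_def
      by (intro integrable_mult_right) auto
    ultimately show ?thesis
      by (subst integrable_cong_AE) (auto simp: S2_def S3_def P'_def)
  qed
  have C1: "f C1_differentiable_on UNIV"
    and int: "\<And>x. integrable N (\<lambda>\<omega>. r \<omega> * std_normal_density (r \<omega> * x))"
    unfolding f_def by (rule normal_scale_mixture_C1[OF r_meas r_sq])+
  have r_nonneg: "AE \<omega> in N. 0 \<le> r \<omega>"
    using sums_pos
    by eventually_elim (use \<open>0 < c1\<close> \<open>0 < c2\<close> \<open>0 < \<sigma>\<^sub>A\<close> in \<open>simp add: r_def\<close>)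
  have kernel_nonneg: "AE \<omega> in N. 0 \<le> r \<omega> * std_normal_density (r \<omega> * x)" for x
    using r_nonneg by eventually_elim simp
  have f_nonneg: "0 \<le> f x" for x
    unfolding f_def by (rule integral_nonneg_AE[OF kernel_nonneg])
  have f_eq: "(\<integral>\<^sup>+\<omega>. ennreal (r \<omega> * std_normal_density (r \<omega> * x)) \<partial>N) = ennreal (f x)" for x
    unfolding f_def by (rule nn_integral_eq_integral[OF int kernel_nonneg])
  have "distributed N lborel (\<lambda>\<omega>. H (P' \<omega>, Z' \<omega>))
      (\<lambda>x. \<integral>\<^sup>+\<omega>. ennreal (r \<omega> * std_normal_density (r \<omega> * x)) \<partial>N)"
  proof (rule distributed_mixture)
    show "indep_var ?S P' ?S Z'"
      using assms by (simp add: P'_def Z'_def)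
    show "AE \<omega> in N. distributed N lborel (\<lambda>\<omega>'. H (P' \<omega>, Z' \<omega>'))
        (\<lambda>x. ennreal (r \<omega> * std_normal_density (r \<omega> * x)))"
      using AE_summable_powers sums_pos
    proof eventually_elim
      case (elim \<omega>)
      define a where "a = (\<lambda>i. P i \<omega> powr (3/2))"
      have a_sq: "(a i)\<^sup>2 = P i \<omega> ^ 3" for i
      proof -
        have pos: "0 < P i \<omega>"
          using elim by blast
        have "(a i)\<^sup>2 = P i \<omega> powr (3/2 + 3/2)"
          unfolding a_def power2_eq_square by (rule powr_add[symmetric])
        also have "\<dots> = P i \<omega> powr (real 3)"
          by simp
        also have "\<dots> = P i \<omega> ^ 3"
          using pos by (rule powr_realpow)
        finally show ?thesis .
      qed
      have "distributed N lborel (\<lambda>\<omega>'. c2 / (c1 * S2 (P' \<omega>)) * (\<Sum>i. a i * Z i \<omega>'))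
          (\<lambda>x. ennreal (r \<omega> * std_normal_density (r \<omega> * x)))"
      proof (rule distributed_normal_series_scaled)
        show "r \<omega> = 1 / (c2 / (c1 * S2 (P' \<omega>)) * \<sigma>\<^sub>A * sqrt (\<Sum>i. (a i)\<^sup>2))"
          by (simp add: r_def a_sq S3_def P'_def)
      qed (use elim assms \<open>0 < c1\<close> \<open>0 < c2\<close> in \<open>auto simp: a_sq S3_def P'_def\<close>)
      then show ?case
        by (simp add: H_def a_def P'_def Z'_def)
    qed
  qed (use H_meas in auto)
  then have "distr N lborel (\<lambda>\<omega>. H (P' \<omega>, Z' \<omega>)) = density lborel (\<lambda>x. ennreal (f x))"
    by (simp add: f_eq distributed_def)
  moreover have "distr M lborel (\<lambda>\<omega>. V2 \<omega> / V1 \<omega>) = distr N lborel (\<lambda>\<omega>. H (P' \<omega>, Z' \<omega>))"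
  proof -
    have [measurable]: "Z i \<in> borel_measurable N" for i
      using assms by (auto simp: iid_normal_def distributed_def)
    have [measurable]: "V1 \<in> borel_measurable M" "V2 \<in> borel_measurable M"
      by fact+
    have [measurable]: "series_vector \<mu>\<^sub>A P Z \<in> borel_measurable N"
      unfolding series_vector_def[abs_def] by measurable
    have [measurable]: "(\<lambda>v :: real \<times> real. snd v / fst v) \<in> borel_measurable borel"
      unfolding borel_prod[symmetric] by measurable
    have "distr M lborel (\<lambda>\<omega>. V2 \<omega> / V1 \<omega>)
        = distr (distr M borel (\<lambda>\<omega>. (V1 \<omega>, V2 \<omega>))) lborel (\<lambda>v. snd v / fst v)"
      by (subst distr_distr) (auto simp: comp_def)
    also have "\<dots> = distr (distr N borel (series_vector \<mu>\<^sub>A P Z)) lborel (\<lambda>v. snd v / fst v)"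
      by (simp only: assms)
    also have "\<dots> = distr N lborel (\<lambda>\<omega>. H (P' \<omega>, Z' \<omega>))"
      by (subst distr_distr)
         (auto simp: comp_def H_def series_vector_def S2_def P'_def Z'_def c1_def c2_def)
    finally show ?thesis .
  qed
  moreover have "f \<in> borel_measurable borel"
    using C1 by (intro borel_measurable_continuous_onI C1_differentiable_imp_continuous_on)
  ultimately have "distributed M lborel (\<lambda>\<omega>. V2 \<omega> / V1 \<omega>) (\<lambda>x. ennreal (f x))"
    using assms(9,10) unfolding distributed_def by auto
  with f_nonneg C1 show ?thesis
    by blast
qed

end
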